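(* Assume $A,b$ are rational with binary encoding length $\sigma$. Let $0<\delta<2$ and $\gamma,\zeta\ge0$ be such that condition (Q) or condition (RS) of the context holds, and let $\alpha$ and $\bar\rho<1$ be as in the context. Run the momentum method $x_{k+1}=x_k-\delta\,\nabla^Bf_i(x_k)+\gamma(x_k-x_{k-1})$ (with $i=i_k$ drawn according to $\mathcal{R}$ at $x_k$) on the system $Ax\le b$ with $x_0=x_1=0$, and suppose the number of iterations $k$ satisfies $$\frac{4\sigma-4-\log n+\log(1+\alpha)+\log\xi+2\log\psi}{\log(1/\bar\rho)}<k-1 ,$$ where $\log$ is the base-2 logarithm. If the system $Ax\le b$ is feasible, then $$p\le H(\sigma,\xi,\psi,\alpha,k,\bar\rho)=\sqrt{\frac{\xi(1+\alpha)}{n}}\;\psi\;2^{2\sigma-2}\;\bar\rho^{\frac{k-1}{2}},$$ where $p$ is the probability that the current iterate $x_k$ is not a certificate of feasibility. Moreover, $H$ is a decreasing function of $k$.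
   Context: $A\in\mathbb{R}^{m\times n}$ has rows $a_1^T,\dots,a_m^T$, none zero, $b\in\mathbb{R}^m$, $\mathcal{X}=\{x\in\mathbb{R}^n: Ax\le b\}$. $B\in\mathbb{R}^{n\times n}$ is symmetric positive definite, $\|x\|_B^2=x^TBx$, $\|v\|_{B^{-1}}^2=v^TB^{-1}v$, $d_B(x,\mathcal{X})=\inf_{y\in\mathcal{X}}\|x-y\|_B$, and $t^+=\max\{t,0\}$. $S_1,\dots,S_q\in\mathbb{R}^m_+$ are fixed sketching vectors (with $A^TS_i\ne 0$), and $$f_i(x)=\frac{|[S_i^T(Ax-b)]^+|^2}{2\|A^TS_i\|_{B^{-1}}^2},\qquad \nabla^B f_i(x)=\frac{[S_i^T(Ax-b)]^+}{\|A^TS_i\|_{B^{-1}}^2}B^{-1}A^TS_i .$$ A sampling rule $\mathcal{R}$ prescribes, given a current point $x$, how a random index $i\in\{1,\dots,q\}$ is chosen; $f(x)=\mathbb{E}[f_i(x)\mid i\sim\mathcal{R}]$. The constants $\mu_1>0$ and $\mu_2\le1$ are such that $\frac{\mu_1}{2}d_B(x,\mathcal{X})^2\le f(x)\le\frac{\mu_2}{2}d_B(x,\mathcal{X})^2$ for all $x$. Binary encoding length: $\sigma=\sum_i\sum_j\ln(|a_{ij}|+1)+\sum_i\ln(|b_i|+1)+\ln(mn)+2$. Maximum violation: $\theta(x)=\max_i(a_i^Tx-b_i)^+$. A point $x$ is a certificate of feasibility if $\theta(x)<2^{1-\sigma}$. Constants: $\psi=\max_j\|a_j\|_2$, $\xi=\lambda_{\max}(B)/\lambda_{\min}(B)$.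 With $h=1-(2\delta-\delta^2)\mu_1$: Condition (Q): $0<\delta<2$ and $0\le\gamma<\frac{1-\sqrt h}{1-\sqrt h+\delta\sqrt{\mu_2}}$. Condition (RS): $0<\delta<2$, $\zeta\ge0$, $0\le\gamma<\frac{\zeta}{1+\zeta}$ and $\frac{\gamma\mu_2}{\mu_1}<\frac{2}{1+\zeta}-\delta+\gamma\le\frac{1+\gamma}{\delta\mu_1(1+\zeta)}$. Rates: under (Q), $\rho_2=\frac12\big[\sqrt h+\gamma+\sqrt{(\sqrt h-\gamma)^2+4\gamma\delta\sqrt{\mu_2}}\big]\in[0,1)$, for which the method satisfies $\mathbb{E}[d_B(x_{k+1},\mathcal{X})]\le\rho_2^k\,d_B(x_0,\mathcal{X})$. Under (RS), $\alpha\ge0$ and $\rho\in(0,1)$ are constants (depending on $\delta,\gamma,\zeta,\mu_1,\mu_2$) for which the method satisfies $\mathbb{E}[d_B(x_{k+1},\mathcal{X})^2]\le\rho^k(1+\alpha)d_B(x_0,\mathcal{X})^2$ for all $k$. Then $\bar\rho=\max\{\rho_2^2,\rho\}$, where only the quantities whose condition ((Q) for $\rho_2$, (RS) for $\rho$) holds are included in the maximum; if only (Q) holds, $\alpha\ge0$ is arbitrary.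
   Formalization: In the encoding length σ the logarithms are taken to base 2 instead of natural, and each rational entry also contributes log2 of its denominator; with natural logarithms, or without denominators for non-integer data, the claimed bound on p fails. *)

theory Defs
  imports "HOL-Probability.Probability"
begin

section \<open>The system and the geometry given by B\<close>

text \<open>The type \<open>'m\<close> indexes the m constraints, \<open>'n\<close> the n coordinates and \<open>'q\<close> the q sketching
  vectors. The row \<open>a\<^sub>i\<close> is \<open>A $ i\<close>; the order on vectors is componentwise.\<close>

definition feasible_set :: "real^'n^'m \<Rightarrow> real^'m \<Rightarrow> (real^'n) set" where
  "feasible_set A b = {x. A *v x \<le> b}"

definition sym_pos_def :: "real^'n^'n \<Rightarrow> bool" where
  "sym_pos_def B \<longleftrightarrow> transpose B = B \<and> (\<forall>x. x \<noteq> 0 \<longrightarrow> x \<bullet> (B *v x) > 0)"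

text \<open>\<open>norm_B B\<close> is the B-norm, and \<open>norm_B (matrix_inv B)\<close> is its dual.\<close>

definition norm_B :: "real^'n^'n \<Rightarrow> real^'n \<Rightarrow> real" where
  "norm_B B x = sqrt (x \<bullet> (B *v x))"

text \<open>A real infimum, hence meaningful only for nonempty \<open>X\<close>.\<close>

definition dist_B :: "real^'n^'n \<Rightarrow> real^'n \<Rightarrow> (real^'n) set \<Rightarrow> real" where
  "dist_B B x X = (INF y\<in>X. norm_B B (x - y))"

definition eigenvalues :: "real^'n^'n \<Rightarrow> real set" where
  "eigenvalues M = {l. \<exists>v. v \<noteq> 0 \<and> M *v v = l *\<^sub>R v}"

definition cond_number :: "real^'n^'n \<Rightarrow> real" where
  "cond_number B = Max (eigenvalues B) / Min (eigenvalues B)"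

definition max_row_norm :: "real^'n^'m \<Rightarrow> real" where
  "max_row_norm A = Max (range (\<lambda>j. norm (A $ j)))"


section \<open>The momentum method\<close>

definition pos_part :: "real \<Rightarrow> real" where
  "pos_part t = max t 0"

definition sketch_loss ::
  "real^'n^'m \<Rightarrow> real^'m \<Rightarrow> real^'n^'n \<Rightarrow> real^'m \<Rightarrow> real^'n \<Rightarrow> real" where
  "sketch_loss A b B s x =
     \<bar>pos_part (s \<bullet> (A *v x - b))\<bar>\<^sup>2 / (2 * (norm_B (matrix_inv B) (transpose A *v s))\<^sup>2)"

definition sketch_grad ::
  "real^'n^'m \<Rightarrow> real^'m \<Rightarrow> real^'n^'n \<Rightarrow> real^'m \<Rightarrow> real^'n \<Rightarrow> real^'n" where
  "sketch_grad A b B s x =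
     (pos_part (s \<bullet> (A *v x - b)) / (norm_B (matrix_inv B) (transpose A *v s))\<^sup>2)
       *\<^sub>R (matrix_inv B *v (transpose A *v s))"

text \<open>A sampling rule \<open>R\<close> maps the current point to the distribution of the sampled index.\<close>

definition expected_loss ::
  "real^'n^'m \<Rightarrow> real^'m \<Rightarrow> real^'n^'n \<Rightarrow> ('q \<Rightarrow> real^'m) \<Rightarrow> (real^'n \<Rightarrow> 'q pmf) \<Rightarrow> real^'n \<Rightarrow> real"
  where
  "expected_loss A b B S R x = measure_pmf.expectation (R x) (\<lambda>i. sketch_loss A b B (S i) x)"

text \<open>\<open>momentum_pair \<dots> x0 x1 k\<close> is the joint law of \<open>(x\<^sub>k, x\<^sub>k\<^sub>+\<^sub>1)\<close>. The next index is drawn from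
  \<open>R x\<^sub>k\<^sub>+\<^sub>1\<close>, independently of the past given the current point.\<close>

primrec momentum_pair ::
  "real^'n^'m \<Rightarrow> real^'m \<Rightarrow> real^'n^'n \<Rightarrow> ('q \<Rightarrow> real^'m) \<Rightarrow> (real^'n \<Rightarrow> 'q pmf) \<Rightarrow> real \<Rightarrow> real
     \<Rightarrow> real^'n \<Rightarrow> real^'n \<Rightarrow> nat \<Rightarrow> ((real^'n) \<times> (real^'n)) pmf" where
  "momentum_pair A b B S R \<delta> \<gamma> x0 x1 0 = return_pmf (x0, x1)"
| "momentum_pair A b B S R \<delta> \<gamma> x0 x1 (Suc k) =
     bind_pmf (momentum_pair A b B S R \<delta> \<gamma> x0 x1 k) (\<lambda>(u, v).
       map_pmf (\<lambda>i. (v, v - \<delta> *\<^sub>R sketch_grad A b B (S i) v + \<gamma> *\<^sub>R (v - u))) (R v))"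

definition momentum_iterate ::
  "real^'n^'m \<Rightarrow> real^'m \<Rightarrow> real^'n^'n \<Rightarrow> ('q \<Rightarrow> real^'m) \<Rightarrow> (real^'n \<Rightarrow> 'q pmf) \<Rightarrow> real \<Rightarrow> real
     \<Rightarrow> real^'n \<Rightarrow> real^'n \<Rightarrow> nat \<Rightarrow> (real^'n) pmf" where
  "momentum_iterate A b B S R \<delta> \<gamma> x0 x1 k = map_pmf fst (momentum_pair A b B S R \<delta> \<gamma> x0 x1 k)"


section \<open>Parameter conditions and rates\<close>

definition contraction :: "real \<Rightarrow> real \<Rightarrow> real" where
  "contraction \<delta> \<mu>1 = 1 - (2 * \<delta> - \<delta>\<^sup>2) * \<mu>1"

definition cond_Q :: "real \<Rightarrow> real \<Rightarrow> real \<Rightarrow> real \<Rightarrow> bool" where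
  "cond_Q \<delta> \<gamma> \<mu>1 \<mu>2 \<longleftrightarrow>
     0 < \<delta> \<and> \<delta> < 2 \<and> 0 \<le> \<gamma> \<and>
     \<gamma> < (1 - sqrt (contraction \<delta> \<mu>1)) / (1 - sqrt (contraction \<delta> \<mu>1) + \<delta> * sqrt \<mu>2)"

definition cond_RS :: "real \<Rightarrow> real \<Rightarrow> real \<Rightarrow> real \<Rightarrow> real \<Rightarrow> bool" where
  "cond_RS \<delta> \<gamma> \<zeta> \<mu>1 \<mu>2 \<longleftrightarrow>
     0 < \<delta> \<and> \<delta> < 2 \<and> 0 \<le> \<zeta> \<and> 0 \<le> \<gamma> \<and> \<gamma> < \<zeta> / (1 + \<zeta>) \<and>
     \<gamma> * \<mu>2 / \<mu>1 < 2 / (1 + \<zeta>) - \<delta> + \<gamma> \<and>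
     2 / (1 + \<zeta>) - \<delta> + \<gamma> \<le> (1 + \<gamma>) / (\<delta> * \<mu>1 * (1 + \<zeta>))"

definition rho2 :: "real \<Rightarrow> real \<Rightarrow> real \<Rightarrow> real \<Rightarrow> real" where
  "rho2 \<delta> \<gamma> \<mu>1 \<mu>2 =
     (1/2) * (sqrt (contraction \<delta> \<mu>1) + \<gamma> +
              sqrt ((sqrt (contraction \<delta> \<mu>1) - \<gamma>)\<^sup>2 + 4 * \<gamma> * \<delta> * sqrt \<mu>2))"

text \<open>Only the rates whose condition holds enter the maximum; \<open>\<rho>\<close> is the mean square rate
  available under \<open>cond_RS\<close>. The value is meaningful only if one of the conditions holds.\<close>

definition rho_bar :: "real \<Rightarrow> real \<Rightarrow> real \<Rightarrow> real \<Rightarrow> real \<Rightarrow> real \<Rightarrow> real" where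
  "rho_bar \<delta> \<gamma> \<zeta> \<mu>1 \<mu>2 \<rho> =
     Max {r. (cond_Q \<delta> \<gamma> \<mu>1 \<mu>2 \<and> r = (rho2 \<delta> \<gamma> \<mu>1 \<mu>2)\<^sup>2) \<or> (cond_RS \<delta> \<gamma> \<zeta> \<mu>1 \<mu>2 \<and> r = \<rho>)}"


section \<open>Encoding length and certificates of feasibility\<close>

text \<open>The denominator in lowest terms of a rational number.\<close>

definition denominator :: "real \<Rightarrow> nat" where
  "denominator x = (LEAST d. 0 < d \<and> real d * x \<in> \<int>)"

text \<open>Lengths are measured in bits, i.e. with logarithms to base 2. A fraction also pays for its
  denominator; this term vanishes on integers, so on integer data the encoding length is
  \<open>\<Sum>\<^sub>i \<Sum>\<^sub>j log (\<bar>a\<^sub>i\<^sub>j\<bar> + 1) + \<Sum>\<^sub>i log (\<bar>b\<^sub>i\<bar> + 1) + log (m n) + 2\<close>.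
  Neither point is cosmetic. With natural logarithms the sum does not bound the bit size of
  determinants even for integer data (take \<open>- x \<le> - N\<close> with \<open>N\<close> large). Without denominators it
  does not bound the size of solutions (take \<open>- x / N \<le> - 1\<close>).\<close>

definition entry_length :: "real \<Rightarrow> real" where
  "entry_length x = log 2 (\<bar>x\<bar> + 1) + log 2 (real (denominator x))"

definition encoding_length :: "real^'n^'m \<Rightarrow> real^'m \<Rightarrow> real" where
  "encoding_length A b =
     (\<Sum>i\<in>UNIV. \<Sum>j\<in>UNIV. entry_length (A $ i $ j)) + (\<Sum>i\<in>UNIV. entry_length (b $ i))
       + log 2 (real CARD('m) * real CARD('n)) + 2"

definition max_violation :: "real^'n^'m \<Rightarrow> real^'m \<Rightarrow> real^'n \<Rightarrow> real" where
  "max_violation A b x = Max (range (\<lambda>i. pos_part (A $ i \<bullet> x - b $ i)))"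

definition feasibility_certificate :: "real^'n^'m \<Rightarrow> real^'m \<Rightarrow> real^'n \<Rightarrow> bool" where
  "feasibility_certificate A b x \<longleftrightarrow> max_violation A b x < 2 powr (1 - encoding_length A b)"

text \<open>The dimension \<open>n\<close> is an explicit argument. If the rate \<open>\<rho>\<close> is 0, then \<open>powr\<close> makes the
  bound 0 for every \<open>k\<close>.\<close>

definition failure_bound :: "nat \<Rightarrow> real \<Rightarrow> real \<Rightarrow> real \<Rightarrow> real \<Rightarrow> nat \<Rightarrow> real \<Rightarrow> real" where
  "failure_bound n \<sigma> \<xi> \<psi> \<alpha> k \<rho> =
     sqrt (\<xi> * (1 + \<alpha>) / real n) * \<psi> * 2 powr (2 * \<sigma> - 2) * \<rho> powr ((real k - 1) / 2)"

end

theory Submission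
  imports Defs
begin

text \<open>By Markov's inequality it suffices to bound the expected maximum violation, which is at most
  \<open>\<psi> / sqrt \<lambda>\<^sub>m\<^sub>i\<^sub>n\<close> times the expected B-distance to the feasible set. Either the mean square rate
  (with Jensen's inequality) or, under condition (Q), a coupled recursion for the expected distance
  and the expected step length makes this distance decay like \<open>\<rho>bar ^ (k / 2)\<close>. The initial distance
  is controlled by Cramer's rule: a feasible rational system has a solution all of whose
  coordinates are quotients of determinants, hence bounded in terms of the encoding length.\<close>

section \<open>Quadratic forms and the B-distance\<close>

text \<open>A polyhedron may contain a line and then has no vertex at which to apply Cramer's rule;
  equations \<open>x $ j = 0\<close> for vanishing coordinates stand in for the missing tight
  constraints. The infimum in \<open>dist_B\<close> is never shown to be attained: lower bounds on a
  distance are proved against an arbitrary feasible \<open>y\<close> and passed to the infimum.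
  Momentum prevents a recursion for the distance alone, since the new point also moves by \<gamma>
  times the previous step; hence the step length is tracked alongside. The factor
  \<open>2 powr (2 * \<sigma> - 2)\<close> consists of two equal parts: one from dividing by the
  threshold in Markov's inequality, one from the size of the small solution.\<close>

lemma inner_matrix_symmetric:
  fixes M :: "real^'n^'n"
  assumes "transpose M = M"
  shows "x \<bullet> (M *v y) = y \<bullet> (M *v x)"
  by (metis assms dot_lmul_matrix inner_commute transpose_matrix_vector)

text \<open>If \<open>w = M *v v\<close> were nonzero, a small move from \<open>v\<close> in the
  direction \<open>- w\<close> would make the form negative, because the first-order change
  dominates.\<close>

lemma psd_null_vector:
  fixes M :: "real^'n^'n"
  assumes sym: "transpose M = M" and psd: "\<And>x. 0 \<le> x \<bullet> (M *v x)"
    and v: "v \<bullet> (M *v v) = 0"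
  shows "M *v v = 0"
proof (rule ccontr)
  assume nz: "M *v v \<noteq> 0"
  define w where "w = M *v v"
  define q where "q = w \<bullet> (M *v w)"
  define p where "p = w \<bullet> w"
  have p: "p > 0" using nz by (simp add: p_def w_def)
  have q: "q \<ge> 0" using psd by (simp add: q_def)
  have pv: "v \<bullet> (M *v w) = p"
    using inner_matrix_symmetric[OF sym, of v w] by (simp add: p_def w_def)
  \<comment> \<open>Small enough for the linear term to win, and well defined even if
    \<open>q = 0\<close>.\<close>
  define t where "t = p / (q + 1)"
  have p_eq: "p = t * (q + 1)" and t: "t > 0" using p q by (simp_all add: t_def)
  have "0 \<le> (v - t *\<^sub>R w) \<bullet> (M *v (v - t *\<^sub>R w))" by (rule psd)
  also have "\<dots> = - 2 * t * p + t\<^sup>2 * q"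
    using v pv
    by (simp add: matrix_vector_mult_diff_distrib matrix_vector_mult_scaleR inner_diff_left inner_diff_right
        flip: w_def p_def q_def) (simp add: algebra_simps power2_eq_square)
  also have "\<dots> = - (t\<^sup>2 * (q + 2))"
    unfolding p_eq by (simp add: algebra_simps power2_eq_square)
  also have "\<dots> < 0" using t q by simp
  finally show False by simp
qed

text \<open>A maximiser \<open>v\<close> of the Rayleigh quotient, with value \<open>c\<close>, is a null vector of the positive
  semidefinite matrix \<open>c I - M\<close>.\<close>

lemma symmetric_eigenvalue_upper:
  fixes M :: "real^'n^'n"
  assumes sym: "transpose M = M"
  obtains c where "c \<in> eigenvalues M" "\<And>x. x \<bullet> (M *v x) \<le> c * (x \<bullet> x)"
proof -
  have cont: "continuous_on (sphere 0 1) (\<lambda>x. x \<bullet> (M *v x))"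
    by (intro continuous_on_inner continuous_on_id matrix_vector_mult_linear_continuous_on)
  have ne: "sphere (0::real^'n) 1 \<noteq> {}" by simp
  from continuous_attains_sup[OF compact_sphere ne cont] obtain v
    where v: "v \<in> sphere 0 1"
    and max: "\<And>x. x \<in> sphere 0 1 \<Longrightarrow> x \<bullet> (M *v x) \<le> v \<bullet> (M *v v)"
    by blast
  define c where "c = v \<bullet> (M *v v)"
  have vv: "v \<bullet> v = 1" using v by (simp add: norm_eq_1)
  have bound: "x \<bullet> (M *v x) \<le> c * (x \<bullet> x)" for x
  proof (cases "x = 0")
    case False
    have "inverse (norm x) *\<^sub>R x \<in> sphere 0 1" using False by simp
    from max[OF this] have "inverse (norm x) * (inverse (norm x) * (x \<bullet> (M *v x))) \<le> c"
      by (simp add: c_def matrix_vector_mult_scaleR)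
    then have "(norm x)\<^sup>2 * (inverse (norm x) * (inverse (norm x) * (x \<bullet> (M *v x)))) \<le> (norm x)\<^sup>2 * c"
      by (intro mult_left_mono) auto
    moreover have "(norm x)\<^sup>2 * (inverse (norm x) * (inverse (norm x) * (x \<bullet> (M *v x)))) = x \<bullet> (M *v x)"
      using False by (simp add: power2_eq_square field_simps)
    ultimately show ?thesis by (simp add: dot_square_norm mult.commute)
  qed simp
  define N where "N = c *\<^sub>R mat 1 - M"
  have Nv: "N *v x = c *\<^sub>R x - M *v x" for x
    by (simp add: N_def matrix_vector_mult_diff_rdistrib flip: scaleR_matrix_vector_assoc)
  have "N *v v = 0"
  proof (rule psd_null_vector)
    show "transpose N = N" using sym unfolding N_def
      by (auto simp: transpose_def vec_eq_iff mat_def)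
  qed (use bound vv in \<open>auto simp: Nv inner_diff_right c_def\<close>)
  then have "M *v v = c *\<^sub>R v" by (simp add: Nv)
  moreover have "v \<noteq> 0" using vv by auto
  ultimately have "c \<in> eigenvalues M" by (auto simp: eigenvalues_def)
  with bound that show thesis by blast
qed

lemma symmetric_eigenvalue_lower:
  fixes M :: "real^'n^'n"
  assumes sym: "transpose M = M"
  obtains c where "c \<in> eigenvalues M" "\<And>x. c * (x \<bullet> x) \<le> x \<bullet> (M *v x)"
proof -
  have neg: "(- M) *v x = - (M *v x)" for x
    by (simp add: vec_eq_iff matrix_vector_mult_def sum_negf)
  have "transpose (- M) = - M" using sym by (simp add: transpose_def vec_eq_iff)
  then obtain c where c: "c \<in> eigenvalues (- M)" "\<And>x. x \<bullet> ((- M) *v x) \<le> c * (x \<bullet> x)"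
    using symmetric_eigenvalue_upper by blast
  then obtain v where "v \<noteq> 0" "- (M *v v) = c *\<^sub>R v" by (auto simp: eigenvalues_def neg)
  then have "v \<noteq> 0" "M *v v = (- c) *\<^sub>R v" by (simp_all add: minus_equation_iff[of "M *v v"])
  then have "- c \<in> eigenvalues M" unfolding eigenvalues_def by blast
  moreover have "- c * (x \<bullet> x) \<le> x \<bullet> (M *v x)" for x
    using c(2)[of x] by (simp add: neg)
  ultimately show thesis using that by blast
qed

text \<open>\<open>Min\<close> and \<open>Max\<close> in \<open>cond_number\<close> are meaningful
  only on a finite set. Eigenvectors for distinct eigenvalues are orthogonal, hence independent, and
  independent sets are finite.\<close>

lemma finite_eigenvalues_symmetric:
  fixes M :: "real^'n^'n"
  assumes sym: "transpose M = M"
  shows "finite (eigenvalues M)"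
proof -
  have "\<exists>f. \<forall>l\<in>eigenvalues M. f l \<noteq> 0 \<and> M *v f l = l *\<^sub>R f l"
    by (rule bchoice) (auto simp: eigenvalues_def)
  then obtain f where f: "\<And>l. l \<in> eigenvalues M \<Longrightarrow> f l \<noteq> 0"
    "\<And>l. l \<in> eigenvalues M \<Longrightarrow> M *v f l = l *\<^sub>R f l" by blast
  have orth: "f l \<bullet> f l' = 0" if "l \<in> eigenvalues M" "l' \<in> eigenvalues M" "l \<noteq> l'" for l l'
    using inner_matrix_symmetric[OF sym, of "f l" "f l'"] f that
    by (simp add: inner_commute)
  have "inj_on f (eigenvalues M)"
  proof (rule inj_onI, rule ccontr)
    fix l l' assume *: "l \<in> eigenvalues M" "l' \<in> eigenvalues M" "f l = f l'" "l \<noteq> l'"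
    then have "f l \<bullet> f l = 0" using orth[of l l'] by simp
    then show False using f(1) * by simp
  qed
  moreover have "independent (f ` eigenvalues M)"
    using f(1) orth by (intro pairwise_orthogonal_independent) (auto simp: pairwise_def orthogonal_def)
  ultimately show ?thesis
    using finiteI_independent finite_imageD by blast
qed

text \<open>The extremal Rayleigh value is some eigenvalue, hence lies between \<open>Min\<close>
  and \<open>Max\<close>; there is no need to identify it with either.\<close>

lemma rayleigh_bounds:
  fixes M :: "real^'n^'n"
  assumes sym: "transpose M = M"
  shows "Min (eigenvalues M) * (x \<bullet> x) \<le> x \<bullet> (M *v x)"
    and "x \<bullet> (M *v x) \<le> Max (eigenvalues M) * (x \<bullet> x)"
proof -
  note fin = finite_eigenvalues_symmetric[OF sym]
  obtain c where c: "c \<in> eigenvalues M" "\<And>x. c * (x \<bullet> x) \<le> x \<bullet> (M *v x)"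
    using symmetric_eigenvalue_lower[OF sym] by blast
  have "Min (eigenvalues M) * (x \<bullet> x) \<le> c * (x \<bullet> x)"
    using fin c(1) by (intro mult_right_mono) auto
  with c(2) show "Min (eigenvalues M) * (x \<bullet> x) \<le> x \<bullet> (M *v x)" by (meson order_trans)
  obtain d where d: "d \<in> eigenvalues M" "\<And>x. x \<bullet> (M *v x) \<le> d * (x \<bullet> x)"
    using symmetric_eigenvalue_upper[OF sym] by blast
  have "d * (x \<bullet> x) \<le> Max (eigenvalues M) * (x \<bullet> x)"
    using fin d(1) by (intro mult_right_mono) auto
  with d(2) show "x \<bullet> (M *v x) \<le> Max (eigenvalues M) * (x \<bullet> x)" by (meson order_trans)
qed

lemma spd_eigenvalues_pos:
  fixes B :: "real^'n^'n"
  assumes B: "sym_pos_def B"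
  shows "0 < Min (eigenvalues B)" and "Min (eigenvalues B) \<le> Max (eigenvalues B)"
proof -
  have sym: "transpose B = B" using B by (simp add: sym_pos_def_def)
  note fin = finite_eigenvalues_symmetric[OF sym]
  obtain c where c: "c \<in> eigenvalues B" using symmetric_eigenvalue_lower[OF sym] by blast
  then have "Min (eigenvalues B) \<in> eigenvalues B" using fin by (intro Min_in) auto
  then obtain v where v: "v \<noteq> 0" "B *v v = Min (eigenvalues B) *\<^sub>R v" by (auto simp: eigenvalues_def)
  have "0 < v \<bullet> (B *v v)" using B v(1) by (simp add: sym_pos_def_def)
  then have "0 < Min (eigenvalues B) * (v \<bullet> v)" by (simp add: v(2))
  moreover have "0 < v \<bullet> v" using v(1) by simp
  ultimately show "0 < Min (eigenvalues B)" by (rule zero_less_mult_pos2)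
  show "Min (eigenvalues B) \<le> Max (eigenvalues B)"
    by (rule order_trans[OF Min_le[OF fin c] Max_ge[OF fin c]])
qed

section \<open>The B-norm and its dual\<close>

lemma sym_pos_def_nonneg: "sym_pos_def B \<Longrightarrow> 0 \<le> x \<bullet> (B *v x)"
proof (cases "x = 0")
  case False
  moreover assume "sym_pos_def B"
  ultimately have "0 < x \<bullet> (B *v x)" unfolding sym_pos_def_def by blast
  then show ?thesis by (rule less_imp_le)
qed simp

lemma norm_B_nonneg [simp]: "sym_pos_def B \<Longrightarrow> 0 \<le> norm_B B x"
  by (simp add: norm_B_def sym_pos_def_nonneg)

lemma norm_B_squared: "sym_pos_def B \<Longrightarrow> (norm_B B x)\<^sup>2 = x \<bullet> (B *v x)"
  by (simp add: norm_B_def sym_pos_def_nonneg)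

lemma norm_B_scaleR: "norm_B B (c *\<^sub>R x) = \<bar>c\<bar> * norm_B B x"
  by (simp add: norm_B_def matrix_vector_mult_scaleR real_sqrt_mult flip: mult.assoc)

text \<open>The vector \<open>c *\<^sub>R x - t *\<^sub>R y\<close> is \<open>c\<close> times the
  component of \<open>x\<close> that is B-orthogonal to \<open>y\<close>; its squared B-norm is
  nonnegative.\<close>

lemma norm_B_Cauchy_Schwarz:
  assumes B: "sym_pos_def B"
  shows "x \<bullet> (B *v y) \<le> norm_B B x * norm_B B y"
proof (cases "y = 0")
  case False
  define c where "c = y \<bullet> (B *v y)"
  define t where "t = x \<bullet> (B *v y)"
  have c: "c > 0" using B False by (simp add: c_def sym_pos_def_def)
  have yx: "y \<bullet> (B *v x) = t"
    using inner_matrix_symmetric[of B x y] B by (simp add: t_def sym_pos_def_def)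
  have "0 \<le> (norm_B B (c *\<^sub>R x - t *\<^sub>R y))\<^sup>2" by simp
  also have "\<dots> = c * (c * (x \<bullet> (B *v x)) - t\<^sup>2)"
    using yx unfolding norm_B_squared[OF B]
    by (simp add: matrix_vector_mult_diff_distrib matrix_vector_mult_scaleR inner_diff_left
        inner_diff_right power2_eq_square algebra_simps flip: t_def c_def)
  finally have "t\<^sup>2 \<le> c * (x \<bullet> (B *v x))" using c by (simp add: zero_le_mult_iff)
  also have "\<dots> = (norm_B B x * norm_B B y)\<^sup>2"
    by (simp add: power_mult_distrib norm_B_squared[OF B] c_def)
  finally show ?thesis
    using B by (auto simp: t_def intro: power2_le_imp_le)
qed (use B in auto)

lemma norm_B_triangle:
  assumes B: "sym_pos_def B"
  shows "norm_B B (x + y) \<le> norm_B B x + norm_B B y"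
proof (rule power2_le_imp_le)
  have "y \<bullet> (B *v x) = x \<bullet> (B *v y)"
    using inner_matrix_symmetric[of B] B by (simp add: sym_pos_def_def)
  then have "(norm_B B (x + y))\<^sup>2 = (norm_B B x)\<^sup>2 + 2 * (x \<bullet> (B *v y)) + (norm_B B y)\<^sup>2"
    by (simp add: norm_B_squared[OF B] matrix_vector_right_distrib inner_add_left inner_add_right)
  also have "\<dots> \<le> (norm_B B x + norm_B B y)\<^sup>2"
    using norm_B_Cauchy_Schwarz[OF B, of x y] by (simp add: power2_sum)
  finally show "(norm_B B (x + y))\<^sup>2 \<le> (norm_B B x + norm_B B y)\<^sup>2" .
qed (use B in auto)

lemma norm_B_bounds:
  assumes B: "sym_pos_def B"
  shows "sqrt (Min (eigenvalues B)) * norm x \<le> norm_B B x"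
    and "norm_B B x \<le> sqrt (Max (eigenvalues B)) * norm x"
proof -
  have sym: "transpose B = B" using B by (simp add: sym_pos_def_def)
  show "sqrt (Min (eigenvalues B)) * norm x \<le> norm_B B x"
    "norm_B B x \<le> sqrt (Max (eigenvalues B)) * norm x"
    using rayleigh_bounds[OF sym, of x]
    by (simp_all add: norm_B_def norm_eq_sqrt_inner flip: real_sqrt_mult)
qed

lemma spd_matrix_inv_right:
  assumes B: "sym_pos_def B"
  shows "B *v (matrix_inv B *v x) = x"
proof -
  have "B *v z = 0 \<Longrightarrow> z = 0" for z
    using B unfolding sym_pos_def_def by (metis inner_zero_right less_irrefl)
  then have "invertible B"
    by (metis invertible_left_inverse matrix_left_invertible_ker)
  then have "B ** matrix_inv B = mat 1"
    unfolding invertible_def matrix_inv_def by (rule someI2_ex) blast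
  then show ?thesis by (simp add: matrix_vector_mul_assoc)
qed

text \<open>Writing \<open>x\<close> as \<open>B *v (matrix_inv B *v x)\<close> turns the inverse
  form into the B-form. This supplies the nonnegativity under the root of the dual norm without a
  separate proof that the inverse is positive definite.\<close>

lemma norm_B_inverse_squared:
  assumes B: "sym_pos_def B"
  shows "(norm_B (matrix_inv B) x)\<^sup>2 = (norm_B B (matrix_inv B *v x))\<^sup>2"
    and "(norm_B B (matrix_inv B *v x))\<^sup>2 = x \<bullet> (matrix_inv B *v x)"
proof -
  have eq: "(norm_B B (matrix_inv B *v x))\<^sup>2 = x \<bullet> (matrix_inv B *v x)"
    by (simp add: norm_B_squared[OF B] spd_matrix_inv_right[OF B] inner_commute)
  moreover have "0 \<le> x \<bullet> (matrix_inv B *v x)" by (metis eq zero_le_power2)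
  ultimately show "(norm_B (matrix_inv B) x)\<^sup>2 = (norm_B B (matrix_inv B *v x))\<^sup>2"
    "(norm_B B (matrix_inv B *v x))\<^sup>2 = x \<bullet> (matrix_inv B *v x)"
    by (simp_all add: norm_B_def)
qed

lemma norm_B_inverse_pos:
  assumes B: "sym_pos_def B" and x: "x \<noteq> 0"
  shows "0 < (norm_B (matrix_inv B) x)\<^sup>2"
proof -
  have "matrix_inv B *v x \<noteq> 0"
    using spd_matrix_inv_right[OF B, of x] x by auto
  then show ?thesis
    using B unfolding norm_B_inverse_squared(1)[OF B] norm_B_squared[OF B] by (simp add: sym_pos_def_def)
qed

section \<open>Distance to the feasible set and maximum violation\<close>

lemma dist_B_le: "sym_pos_def B \<Longrightarrow> y \<in> X \<Longrightarrow> dist_B B x X \<le> norm_B B (x - y)"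
  unfolding dist_B_def by (rule cINF_lower) (auto intro!: bdd_belowI2[where m = 0])

lemma dist_B_greatest:
  "X \<noteq> {} \<Longrightarrow> (\<And>y. y \<in> X \<Longrightarrow> c \<le> norm_B B (x - y)) \<Longrightarrow> c \<le> dist_B B x X"
  unfolding dist_B_def by (rule cINF_greatest)

lemma dist_B_nonneg: "sym_pos_def B \<Longrightarrow> X \<noteq> {} \<Longrightarrow> 0 \<le> dist_B B x X"
  by (rule dist_B_greatest) auto

lemma dist_B_add_le:
  assumes B: "sym_pos_def B" and X: "X \<noteq> {}"
  shows "dist_B B (x + z) X \<le> dist_B B x X + norm_B B z"
proof -
  have "dist_B B (x + z) X - norm_B B z \<le> norm_B B (x - y)" if "y \<in> X" for y
    using dist_B_le[OF B that, of "x + z"] norm_B_triangle[OF B, of "x - y" z]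
    by (simp add: algebra_simps)
  from dist_B_greatest[OF X this] show ?thesis by simp
qed

text \<open>For each feasible \<open>y\<close>, Cauchy-Schwarz on every row bounds the violation by
  the largest row norm times \<open>norm (x - y)\<close>; the smallest eigenvalue of
  \<open>B\<close> converts this to the B-norm.\<close>

lemma max_violation_le_dist:
  fixes A :: "real^'n^'m"
  assumes B: "sym_pos_def B" and X: "feasible_set A b \<noteq> {}"
  shows "sqrt (Min (eigenvalues B)) * max_violation A b x
    \<le> max_row_norm A * dist_B B x (feasible_set A b)"
proof -
  have Mn: "0 \<le> sqrt (Min (eigenvalues B))" using spd_eigenvalues_pos(1)[OF B] by simp
  have row: "norm (A $ i) \<le> max_row_norm A" for i
    unfolding max_row_norm_def by (rule Max_ge) auto
  then have psi: "0 \<le> max_row_norm A" using norm_ge_zero order_trans by blast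
  have viol: "sqrt (Min (eigenvalues B)) * max_violation A b x \<le> max_row_norm A * norm_B B (x - y)"
    if y: "y \<in> feasible_set A b" for y
  proof -
    have "pos_part (A $ i \<bullet> x - b $ i) \<le> max_row_norm A * norm (x - y)" for i
    proof -
      have "A $ i \<bullet> y \<le> b $ i"
        using y by (simp add: feasible_set_def less_eq_vec_def matrix_vector_mul_component)
      then have "A $ i \<bullet> x - b $ i \<le> A $ i \<bullet> (x - y)" by (simp add: inner_diff_right)
      also have "\<dots> \<le> norm (A $ i) * norm (x - y)" by (rule norm_cauchy_schwarz)
      also have "\<dots> \<le> max_row_norm A * norm (x - y)" using row by (intro mult_right_mono) auto
      finally show ?thesis using psi by (simp add: pos_part_def)
    qed
    then have "max_violation A b x \<le> max_row_norm A * norm (x - y)"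
      unfolding max_violation_def by (subst Max_le_iff) auto
    then have "sqrt (Min (eigenvalues B)) * max_violation A b x
        \<le> max_row_norm A * (sqrt (Min (eigenvalues B)) * norm (x - y))"
      using Mn by (metis mult.left_commute mult_left_mono)
    also have "\<dots> \<le> max_row_norm A * norm_B B (x - y)"
      using psi norm_B_bounds(1)[OF B] by (intro mult_left_mono) auto
    finally show ?thesis .
  qed
  show ?thesis
  \<comment> \<open>Passing to the infimum divides by the row norm; if that is 0, the estimate at a
    single feasible point suffices.\<close>
  proof (cases "max_row_norm A = 0")
    case True
    then show ?thesis using viol X by fastforce
  next
    case False
    with psi have "0 < max_row_norm A" by simp
    then show ?thesis
      using dist_B_greatest[OF X, of "sqrt (Min (eigenvalues B)) * max_violation A b x / max_row_norm A" B x] viol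
      by (simp add: field_simps)
  qed
qed

lemma max_violation_nonneg: "0 \<le> max_violation A b x"
proof -
  have "pos_part (A $ undefined \<bullet> x - b $ undefined) \<le> max_violation A b x"
    unfolding max_violation_def by (rule Max_ge) auto
  then show ?thesis by (simp add: pos_part_def)
qed


section \<open>Small solutions of rational systems\<close>

lemma denominator_rational:
  assumes "x \<in> \<rat>"
  shows "0 < denominator x" and "real (denominator x) * x \<in> \<int>"
proof -
  obtain i n where "n \<noteq> 0" "x = real_of_int i / real n"
    using assms by (auto simp: Rats_eq_int_div_nat)
  then have "0 < n \<and> real n * x \<in> \<int>" by simp
  then have "0 < denominator x \<and> real (denominator x) * x \<in> \<int>"
    unfolding denominator_def by (rule LeastI)
  then show "0 < denominator x" "real (denominator x) * x \<in> \<int>" by auto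
qed

lemma two_powr_entry_length:
  assumes "x \<in> \<rat>"
  shows "2 powr entry_length x = (1 + \<bar>x\<bar>) * real (denominator x)"
  using denominator_rational(1)[OF assms] by (simp add: entry_length_def powr_add add_ac)

text \<open>The Leibniz sum without signs, enlarged from permutations to all maps from rows to
  columns, factors into the product of the row sums.\<close>

lemma abs_det_le_prod_row_sums:
  fixes M :: "real^'n^'n"
  shows "\<bar>det M\<bar> \<le> (\<Prod>i\<in>UNIV. \<Sum>j\<in>UNIV. \<bar>M $ i $ j\<bar>)"
proof -
  have "\<bar>det M\<bar> \<le> (\<Sum>p | p permutes (UNIV::'n set). \<bar>of_int (sign p) * (\<Prod>i\<in>UNIV. M $ i $ p i)\<bar>)"
    unfolding det_def by (rule sum_abs)
  also have "\<dots> = (\<Sum>p | p permutes (UNIV::'n set). \<Prod>i\<in>UNIV. \<bar>M $ i $ p i\<bar>)"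
    by (intro sum.cong) (auto simp: abs_mult abs_prod sign_def)
  also have "\<dots> \<le> (\<Sum>p\<in>UNIV. \<Prod>i\<in>UNIV. \<bar>M $ i $ p i\<bar>)"
    by (rule sum_mono2) (auto intro: prod_nonneg)
  also have "\<dots> = (\<Prod>i\<in>UNIV. \<Sum>j\<in>UNIV. \<bar>M $ i $ j\<bar>)"
    by (simp add: prod_sum_PiE PiE_UNIV_domain)
  finally show ?thesis .
qed

lemma one_plus_sum_le_prod:
  fixes f :: "'a \<Rightarrow> real"
  assumes "finite I" "\<And>i. i \<in> I \<Longrightarrow> 0 \<le> f i"
  shows "1 + sum f I \<le> (\<Prod>i\<in>I. 1 + f i)"
  using assms
proof (induction I rule: finite_induct)
  case (insert i I)
  have "1 + sum f (insert i I) \<le> (1 + f i) * (1 + sum f I)"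
    using insert by (simp add: algebra_simps sum_nonneg)
  also have "\<dots> \<le> (1 + f i) * (\<Prod>i\<in>I. 1 + f i)"
    using insert by (intro mult_left_mono) auto
  finally show ?case using insert by simp
qed simp

text \<open>Meant for a square matrix whose rows in \<open>J\<close> come from distinct constraints
  via \<open>h\<close>, while the others are unit vectors: a product over its rows is compared with
  one over all constraints.\<close>

lemma prod_le_prod_inj:
  fixes g :: "'a::finite \<Rightarrow> real" and u :: "'b::finite \<Rightarrow> real"
  assumes inj: "inj_on h J" and u: "\<And>i. 1 \<le> u i" and g: "\<And>j. 0 \<le> g j"
    and J: "\<And>j. j \<in> J \<Longrightarrow> g j \<le> u (h j)" and notJ: "\<And>j. j \<notin> J \<Longrightarrow> g j \<le> 1"
  shows "prod g UNIV \<le> prod u UNIV"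
proof -
  have "prod g UNIV = prod g J * prod g (UNIV - J)"
    by (metis finite prod.subset_diff subset_UNIV mult.commute)
  also have "\<dots> \<le> prod (u \<circ> h) J * 1"
    using g J notJ u order_trans[OF zero_le_one u]
    by (intro mult_mono prod_mono prod_le_1 prod_nonneg) auto
  also have "\<dots> = prod u (h ` J)" using inj by (simp add: prod.reindex)
  also have "\<dots> \<le> prod u UNIV"
    using u order_trans[OF zero_le_one u] by (intro prod_mono2) auto
  finally show ?thesis .
qed

lemma scaled_det_Ints:
  fixes M :: "real^'n^'n"
  assumes "\<And>i j. d i * M $ i $ j \<in> \<int>"
  shows "prod d UNIV * det M \<in> \<int>"
proof -
  have "prod d UNIV * det M = det (\<chi> i. d i *s M $ i)" by (simp add: det_rows_mul)
  also have "\<dots> \<in> \<int>"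
    unfolding det_def using assms by (intro Ints_sum Ints_mult Ints_prod) auto
  finally show ?thesis .
qed

text \<open>A feasible point with the largest number of tight constraints, where the coordinates
  equal to 0 also count: along a direction preserving all of these, some further constraint or
  coordinate would become tight first.\<close>

lemma feasible_set_basic_point:
  fixes A :: "real^'n^'m"
  assumes feas: "feasible_set A b \<noteq> {}"
  obtains x where "x \<in> feasible_set A b"
    and "\<And>v. (\<And>i. A $ i \<bullet> x = b $ i \<Longrightarrow> A $ i \<bullet> v = 0) \<Longrightarrow> (\<And>j. x $ j = 0 \<Longrightarrow> v $ j = 0) \<Longrightarrow> v = 0"
proof -
  have mem: "x \<in> feasible_set A b \<longleftrightarrow> (\<forall>i. A $ i \<bullet> x \<le> b $ i)" for x
    by (simp add: feasible_set_def less_eq_vec_def matrix_vector_mul_component)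
  define T1 where "T1 x = {i. A $ i \<bullet> x = b $ i}" for x
  define T2 where "T2 x = {j. x $ j = 0}" for x :: "real^'n"
  define T where "T x = card (T1 x) + card (T2 x)" for x
  have "T x \<le> CARD('m) + CARD('n)" for x
    unfolding T_def by (intro add_mono card_mono) auto
  then have "\<forall>x. x \<in> feasible_set A b \<longrightarrow> T x < Suc (CARD('m) + CARD('n))"
    by (simp add: less_Suc_eq_le)
  then obtain x where x: "x \<in> feasible_set A b"
    and max: "\<And>y. y \<in> feasible_set A b \<Longrightarrow> T y \<le> T x"
    using ex_has_greatest_nat[of "\<lambda>x. x \<in> feasible_set A b" _ T] feas by (metis all_not_in_conv)
  have no_more: False
    if y: "y \<in> feasible_set A b" "T1 x \<subseteq> T1 y" "T2 x \<subseteq> T2 y" "T1 x \<noteq> T1 y \<or> T2 x \<noteq> T2 y" for y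
  proof -
    have "card (T1 x) \<le> card (T1 y)" "card (T2 x) \<le> card (T2 y)"
      using y by (auto intro: card_mono)
    moreover have "card (T1 x) < card (T1 y) \<or> card (T2 x) < card (T2 y)"
      using y(2-4) by (metis finite psubsetI psubset_card_mono)
    ultimately show False using max[OF y(1)] by (auto simp: T_def)
  qed
  have "v = 0" if v1: "\<And>i. A $ i \<bullet> x = b $ i \<Longrightarrow> A $ i \<bullet> v = 0" and v2: "\<And>j. x $ j = 0 \<Longrightarrow> v $ j = 0" for v
  proof (rule ccontr)
    assume "v \<noteq> 0"
    then obtain j where j: "v $ j \<noteq> 0" by (auto simp: vec_eq_iff)
    then have xj: "x $ j \<noteq> 0" using v2 by blast
    \<comment> \<open>Scaled so that \<open>x + w\<close> vanishes in coordinate \<open>j\<close>: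
      either \<open>x + w\<close> is feasible and gains a zero coordinate, or a new constraint stops
      the move.\<close>
    define w where "w = - (x $ j / v $ j) *\<^sub>R v"
    have w1: "A $ i \<bullet> w = 0" if "A $ i \<bullet> x = b $ i" for i using v1[OF that] by (simp add: w_def)
    have w2: "w $ l = 0" if "x $ l = 0" for l using v2[OF that] by (simp add: w_def)
    have w3: "(x + w) $ j = 0" using j by (simp add: w_def)
    have T1: "T1 x \<subseteq> T1 (x + t *\<^sub>R w)" and T2: "T2 x \<subseteq> T2 (x + t *\<^sub>R w)" for t
      using w1 w2 by (auto simp: T1_def T2_def inner_add_right)
    show False
    proof (cases "x + w \<in> feasible_set A b")
      case True
      have "j \<in> T2 (x + w)" "j \<notin> T2 x" using w3 xj by (simp_all add: T2_def)
      then show False using no_more[OF True] T1[of 1] T2[of 1] by auto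
    next
      case False
      define V where "V = {i. b $ i < A $ i \<bullet> (x + w)}"
      \<comment> \<open>Ratio test: \<open>r i\<close> is the step length at which constraint
        \<open>i\<close> becomes tight. The smallest ratio over the constraints violated at
        \<open>x + w\<close> is the longest feasible step.\<close>
      define r where "r i = (b $ i - A $ i \<bullet> x) / (A $ i \<bullet> w)" for i
      have V: "V \<noteq> {}" using False by (auto simp: V_def mem not_le)
      have pos: "0 < b $ i - A $ i \<bullet> x" "b $ i - A $ i \<bullet> x < A $ i \<bullet> w" if "i \<in> V" for i
      proof -
        have "A $ i \<bullet> x \<le> b $ i" using x by (simp add: mem)
        moreover have "b $ i < A $ i \<bullet> x + A $ i \<bullet> w" using that by (simp add: V_def inner_add_right)
        moreover from this have "A $ i \<bullet> x \<noteq> b $ i" using w1[of i] by auto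
        ultimately show "0 < b $ i - A $ i \<bullet> x" "b $ i - A $ i \<bullet> x < A $ i \<bullet> w" by auto
      qed
      define t where "t = Min (r ` V)"
      have "t \<in> r ` V" unfolding t_def using V by (intro Min_in) auto
      then obtain i0 where i0: "i0 \<in> V" "t = r i0" by auto
      have t: "0 < t" "t \<le> 1" using pos[OF i0(1)] unfolding i0(2) r_def by (simp_all add: field_simps)
      have "A $ i \<bullet> (x + t *\<^sub>R w) \<le> b $ i" for i
      proof (cases "i \<in> V")
        case True
        then have "t \<le> r i" unfolding t_def by simp
        then show ?thesis using pos[OF True] by (simp add: r_def inner_add_right field_simps)
      next
        case False
        have "(1 - t) * (A $ i \<bullet> x) + t * (A $ i \<bullet> (x + w)) \<le> (1 - t) * b $ i + t * b $ i"
          using t x False by (intro add_mono mult_left_mono) (auto simp: mem V_def)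
        then show ?thesis by (simp add: inner_add_right algebra_simps)
      qed
      then have "x + t *\<^sub>R w \<in> feasible_set A b" by (simp add: mem)
      moreover have "i0 \<in> T1 (x + t *\<^sub>R w)" "i0 \<notin> T1 x"
        using pos[OF i0(1)] by (simp_all add: T1_def i0(2) r_def inner_add_right)
      ultimately show False using no_more T1 T2 by blast
    qed
  qed
  with x that show thesis by blast
qed

text \<open>By \<open>basic\<close>, the tight rows and the unit vectors of zero coordinates span
  the space. A basis chosen among them forms an invertible \<open>M\<close>, and Cramer's rule gives
  \<open>x $ k = det N / det M\<close>. Row sums bound the numerator; integrality after clearing
  denominators keeps \<open>det M\<close> away from 0.\<close>

lemma basic_point_coordinate_bound:
  fixes A :: "real^'n^'m"
  assumes Q: "\<And>i j. A $ i $ j \<in> \<rat>"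
    and basic: "\<And>v. (\<And>i. A $ i \<bullet> x = b $ i \<Longrightarrow> A $ i \<bullet> v = 0) \<Longrightarrow> (\<And>j. x $ j = 0 \<Longrightarrow> v $ j = 0) \<Longrightarrow> v = 0"
  shows "\<bar>x $ k\<bar> \<le> (\<Prod>i\<in>UNIV. (\<Prod>j\<in>UNIV. 1 + \<bar>A $ i $ j\<bar>) * (1 + \<bar>b $ i\<bar>)) *
    (\<Prod>i\<in>UNIV. \<Prod>j\<in>UNIV. real (denominator (A $ i $ j)))"
proof -
  define I where "I = {i. A $ i \<bullet> x = b $ i}"
  define V where "V = (\<lambda>i. A $ i) ` I \<union> (\<lambda>j. axis j 1) ` {j. x $ j = 0}"
  have orth: "v = 0" if "\<And>y. y \<in> V \<Longrightarrow> v \<bullet> y = 0" for v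
  proof (rule basic)
    fix i assume "A $ i \<bullet> x = b $ i"
    then show "A $ i \<bullet> v = 0" using that[of "A $ i"] by (auto simp: V_def I_def inner_commute)
  next
    fix j assume "x $ j = 0"
    then show "v $ j = 0" using that[of "axis j 1"] by (auto simp: V_def inner_axis)
  qed
  have span: "span V = UNIV"
  proof (rule ccontr)
    assume "span V \<noteq> UNIV"
    then obtain a where "a \<noteq> 0" "\<forall>y\<in>span V. a \<bullet> y = 0"
      using span_not_UNIV_orthogonal by blast
    then show False using orth[of a] by (simp add: span_base)
  qed
  obtain W where W: "W \<subseteq> V" "independent W" "V \<subseteq> span W" "card W = dim V"
    using basis_exists by blast
  have "card W = CARD('n)"
    using W(4) span dim_span[of V] by simp
  moreover have "finite W" using W(2) by (rule finiteI_independent)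
  ultimately obtain f where f: "bij_betw f (UNIV :: 'n set) W"
    using finite_same_card_bij[OF finite] by metis
  define M where "M = (\<chi> j. f j)"
  have "v = 0" if "M *v v = 0" for v
  proof (rule orth)
    fix y assume "y \<in> V"
    then have "y \<in> span W" using W(3) by blast
    moreover have "orthogonal v w" if w: "w \<in> W" for w
    proof -
      obtain j where "w = f j" using f w by (auto simp: bij_betw_def)
      then have "w \<bullet> v = (M *v v) $ j" by (simp add: M_def matrix_vector_mul_component)
      then show ?thesis using \<open>M *v v = 0\<close> by (simp add: orthogonal_def inner_commute)
    qed
    ultimately show "v \<bullet> y = 0"
      using orthogonal_to_span[of y W v] by (simp add: orthogonal_def)
  qed
  then have "invertible M" by (metis invertible_left_inverse matrix_left_invertible_ker)
  then have det: "det M \<noteq> 0" by (simp add: invertible_det_nz)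

  \<comment> \<open>\<open>J\<close> collects the rows of \<open>M\<close> taken from
    \<open>A\<close>; every other row is the unit vector of a coordinate where \<open>x\<close>
    vanishes.\<close>
  define J where "J = {j. f j \<in> (\<lambda>i. A $ i) ` I}"
  define h where "h j = (SOME i. i \<in> I \<and> f j = A $ i)" for j
  have h: "h j \<in> I \<and> f j = A $ h j" if "j \<in> J" for j
    unfolding h_def by (rule someI_ex) (use that in \<open>auto simp: J_def\<close>)
  have inj: "inj_on h J"
  proof (rule inj_onI)
    fix i j assume "i \<in> J" "j \<in> J" "h i = h j"
    then have "f i = f j" using h by simp
    then show "i = j" using f by (simp add: bij_betw_def inj_def)
  qed
  have ax: "\<exists>l. x $ l = 0 \<and> f j = axis l 1" if "j \<notin> J" for j
  proof -
    have "f j \<in> V" using f W(1) by (auto simp: bij_betw_def)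
    then show ?thesis using that by (auto simp: V_def J_def)
  qed
  have row_value: "(M *v x) $ j = f j \<bullet> x" for j
    by (simp add: M_def matrix_vector_mul_component)

  define u where "u i = (\<Prod>j\<in>UNIV. 1 + \<bar>A $ i $ j\<bar>) * (1 + \<bar>b $ i\<bar>)" for i
  \<comment> \<open>Column \<open>k\<close> of \<open>M\<close> is replaced by the right-hand side
    \<open>M *v x\<close>, whose entries are \<open>b $ h j\<close> for \<open>j\<close> in
    \<open>J\<close> and 0 elsewhere.\<close>
  define N where "N = (\<chi> i j. if j = k then (M *v x) $ i else M $ i $ j)"
  have "\<bar>det N\<bar> \<le> (\<Prod>i\<in>UNIV. \<Sum>j\<in>UNIV. \<bar>N $ i $ j\<bar>)" by (rule abs_det_le_prod_row_sums)
  also have "\<dots> \<le> prod u UNIV"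
  proof (rule prod_le_prod_inj[OF inj])
    have ge1: "1 \<le> (\<Prod>j\<in>UNIV. 1 + \<bar>A $ i $ j\<bar>)" for i by (rule prod_ge_1) simp
    show "1 \<le> u i" for i
      unfolding u_def using mult_mono[OF ge1, of 1 "1 + \<bar>b $ i\<bar>"] order_trans[OF zero_le_one ge1] by simp
    have le: "(\<Sum>l\<in>UNIV. \<bar>N $ j $ l\<bar>) \<le> (\<Sum>l\<in>UNIV. \<bar>f j $ l\<bar>) + \<bar>f j \<bullet> x\<bar>" for j
    proof -
      have "(\<Sum>l\<in>UNIV. \<bar>N $ j $ l\<bar>) \<le> (\<Sum>l\<in>UNIV. \<bar>f j $ l\<bar> + (if l = k then \<bar>f j \<bullet> x\<bar> else 0))"
        by (rule sum_mono) (simp add: N_def row_value, simp add: M_def)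
      then show ?thesis by (simp add: sum.distrib)
    qed
    show "(\<Sum>l\<in>UNIV. \<bar>N $ j $ l\<bar>) \<le> u (h j)" if "j \<in> J" for j
    proof -
      have *: "f j \<bullet> x = b $ h j" "f j = A $ h j" using h[OF that] by (auto simp: I_def)
      have "(\<Sum>l\<in>UNIV. \<bar>N $ j $ l\<bar>) \<le> (\<Sum>l\<in>UNIV. \<bar>A $ h j $ l\<bar>) + \<bar>b $ h j\<bar>"
        using le[of j] * by simp
      also have "\<dots> \<le> (\<Prod>l\<in>UNIV. 1 + \<bar>A $ h j $ l\<bar>) * 1 + 1 * \<bar>b $ h j\<bar>"
        using one_plus_sum_le_prod[of UNIV "\<lambda>l. \<bar>A $ h j $ l\<bar>"] by simp
      also have "\<dots> \<le> u (h j)"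
        unfolding u_def distrib_left using ge1 by (intro add_mono mult_right_mono) auto
      finally show ?thesis .
    qed
    show "(\<Sum>l\<in>UNIV. \<bar>N $ j $ l\<bar>) \<le> 1" if "j \<notin> J" for j
    proof -
      obtain l where l: "x $ l = 0" "f j = axis l 1" using ax \<open>j \<notin> J\<close> by blast
      have "(\<Sum>i\<in>UNIV. \<bar>f j $ i\<bar>) = (\<Sum>i\<in>UNIV. if i = l then 1 else 0)"
        by (rule sum.cong) (auto simp: l axis_def)
      moreover have "f j \<bullet> x = 0" using l by (simp add: inner_axis')
      ultimately show ?thesis using le[of j] by simp
    qed
  qed (simp add: sum_nonneg)
  finally have num: "\<bar>det N\<bar> \<le> prod u UNIV" .

  define w where "w i = (\<Prod>j\<in>UNIV. real (denominator (A $ i $ j)))" for i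
  have den1: "1 \<le> real (denominator (A $ i $ j))" for i j
    using denominator_rational(1)[OF Q[of i j]] by simp
  have w1: "1 \<le> w i" for i unfolding w_def by (rule prod_ge_1) (rule den1)
  \<comment> \<open>A row from \<open>A\<close> is scaled by the product of its denominators; unit
    vectors are already integral.\<close>
  define d where "d j = (if j \<in> J then w (h j) else 1)" for j
  have "d i * M $ i $ j \<in> \<int>" for i j
  proof (cases "i \<in> J")
    case True
    have "w (h i) = real (denominator (A $ h i $ j)) * (\<Prod>l\<in>UNIV - {j}. real (denominator (A $ h i $ l)))"
      unfolding w_def by (subst prod.remove[of UNIV j]) auto
    then have "d i * M $ i $ j = (real (denominator (A $ h i $ j)) * A $ h i $ j) *
        (\<Prod>l\<in>UNIV - {j}. real (denominator (A $ h i $ l)))"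
      using True h[OF True] by (simp add: d_def M_def)
    also have "\<dots> \<in> \<int>" by (intro Ints_mult[OF denominator_rational(2)[OF Q]] Ints_prod) auto
    finally show ?thesis .
  next
    case False
    then obtain l where "f i = axis l 1" using ax by blast
    then show ?thesis using False by (simp add: d_def M_def axis_def)
  qed
  then have "prod d UNIV * det M \<in> \<int>" by (rule scaled_det_Ints)
  moreover have d1: "1 \<le> d j" for j using w1 by (simp add: d_def)
  have "1 \<le> prod d UNIV" by (rule prod_ge_1) (rule d1)
  then have "prod d UNIV * det M \<noteq> 0" using det by (metis mult_eq_0_iff not_one_le_zero)
  ultimately have "1 \<le> \<bar>prod d UNIV * det M\<bar>" by (rule Ints_nonzero_abs_ge1)
  also have "\<dots> = prod d UNIV * \<bar>det M\<bar>"
    using prod_ge_1[of UNIV d] d1 by (simp add: abs_mult)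
  also have "\<dots> \<le> prod w UNIV * \<bar>det M\<bar>"
  proof (rule mult_right_mono[OF prod_le_prod_inj[OF inj]])
    show "0 \<le> d j" for j using order_trans[OF zero_le_one d1] .
  qed (use w1 in \<open>auto simp: d_def\<close>)
  finally have den: "1 \<le> prod w UNIV * \<bar>det M\<bar>" .

  have "det N = x $ k * det M" unfolding N_def by (rule cramer_lemma)
  have "\<bar>x $ k\<bar> * 1 \<le> \<bar>x $ k\<bar> * (prod w UNIV * \<bar>det M\<bar>)" using den by (intro mult_left_mono) auto
  also have "\<dots> = \<bar>det N\<bar> * prod w UNIV" using \<open>det N = x $ k * det M\<close> by (simp add: abs_mult)
  also have "\<dots> \<le> prod u UNIV * prod w UNIV"
    using num w1 by (intro mult_right_mono prod_nonneg) (auto intro: order_trans[OF zero_le_one])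
  finally show ?thesis unfolding u_def w_def by simp
qed

text \<open>Coordinates bounded by \<open>K\<close> give a norm of at most
  \<open>sqrt n * K\<close>; the extra \<open>sqrt n\<close> makes this \<open>n * K\<close>, and
  \<open>2 powr (encoding_length A b - 1)\<close> is exactly \<open>2 * m * n * K\<close>. That
  extra root becomes the \<open>n\<close> under the root of \<open>failure_bound\<close>.\<close>

lemma small_feasible_point:
  fixes A :: "real^'n^'m"
  assumes A: "\<And>i j. A $ i $ j \<in> \<rat>" and b: "\<And>i. b $ i \<in> \<rat>"
    and feas: "feasible_set A b \<noteq> {}"
  obtains x where "x \<in> feasible_set A b"
    and "sqrt (real CARD('n)) * norm x \<le> 2 powr (encoding_length A b - 1)"
proof -
  obtain x where x: "x \<in> feasible_set A b"
    and basic: "\<And>v. (\<And>i. A $ i \<bullet> x = b $ i \<Longrightarrow> A $ i \<bullet> v = 0) \<Longrightarrow> (\<And>j. x $ j = 0 \<Longrightarrow> v $ j = 0) \<Longrightarrow> v = 0"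
    using feasible_set_basic_point[OF feas] by blast
  define K where "K = 2 powr ((\<Sum>i\<in>UNIV. \<Sum>j\<in>UNIV. entry_length (A $ i $ j)) + (\<Sum>i\<in>UNIV. entry_length (b $ i)))"
  have K: "K = (\<Prod>i\<in>UNIV. \<Prod>j\<in>UNIV. (1 + \<bar>A $ i $ j\<bar>) * real (denominator (A $ i $ j))) *
      (\<Prod>i\<in>UNIV. (1 + \<bar>b $ i\<bar>) * real (denominator (b $ i)))"
    by (simp add: K_def powr_add powr_sum two_powr_entry_length A b)
  have coord: "\<bar>x $ k\<bar> \<le> K" for k
  proof -
    have "\<bar>x $ k\<bar> \<le> (\<Prod>i\<in>UNIV. (\<Prod>j\<in>UNIV. 1 + \<bar>A $ i $ j\<bar>) * (1 + \<bar>b $ i\<bar>)) *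
      (\<Prod>i\<in>UNIV. \<Prod>j\<in>UNIV. real (denominator (A $ i $ j)))"
      using basic_point_coordinate_bound[OF A basic] .
    also have "\<dots> \<le> \<dots> * (\<Prod>i\<in>UNIV. real (denominator (b $ i)))"
    proof -
      have "1 \<le> (\<Prod>i\<in>UNIV. real (denominator (b $ i)))"
        by (rule prod_ge_1) (use denominator_rational(1)[OF b] in \<open>simp add: Suc_le_eq\<close>)
      moreover have "0 \<le> (\<Prod>i\<in>UNIV. (\<Prod>j\<in>UNIV. 1 + \<bar>A $ i $ j\<bar>) * (1 + \<bar>b $ i\<bar>)) *
        (\<Prod>i\<in>UNIV. \<Prod>j\<in>UNIV. real (denominator (A $ i $ j)))"
        by (intro mult_nonneg_nonneg prod_nonneg) auto
      ultimately show ?thesis using mult_left_mono by fastforce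
    qed
    also have "\<dots> = K" unfolding K by (simp add: prod.distrib)
    finally show ?thesis .
  qed
  have K0: "0 \<le> K" by (simp add: K_def)
  have m: "1 \<le> real CARD('m)" "1 \<le> real CARD('n)" by (simp_all add: Suc_le_eq)
  have "(norm x)\<^sup>2 = (\<Sum>i\<in>UNIV. \<bar>x $ i\<bar>\<^sup>2)"
    unfolding power2_norm_eq_inner by (simp add: inner_vec_def power2_eq_square)
  also have "\<dots> \<le> (\<Sum>i\<in>(UNIV :: 'n set). K\<^sup>2)" using coord by (intro sum_mono power_mono) auto
  also have "\<dots> = (sqrt (real CARD('n)) * K)\<^sup>2" by (simp add: power_mult_distrib)
  finally have "norm x \<le> sqrt (real CARD('n)) * K" by (rule power2_le_imp_le) (use K0 in auto)
  then have "sqrt (real CARD('n)) * norm x \<le> sqrt (real CARD('n)) * (sqrt (real CARD('n)) * K)"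
    by (intro mult_left_mono) auto
  also have "\<dots> = 1 * (real CARD('n) * K)" by simp
  also have "\<dots> \<le> (2 * real CARD('m)) * (real CARD('n) * K)"
    by (intro mult_right_mono mult_nonneg_nonneg K0) (use m(1) in linarith, simp)
  also have "\<dots> = 2 powr (encoding_length A b - 1)"
  proof -
    have "encoding_length A b - 1 = ((\<Sum>i\<in>UNIV. \<Sum>j\<in>UNIV. entry_length (A $ i $ j)) + (\<Sum>i\<in>UNIV. entry_length (b $ i)))
      + log 2 (real CARD('m) * real CARD('n)) + 1" by (simp add: encoding_length_def)
    moreover have "0 < real CARD('m) * real CARD('n)" using m by simp
    ultimately show ?thesis by (simp add: powr_add K_def)
  qed
  finally show thesis using that[OF x] by simp
qed


section \<open>Decay of the expected distance\<close>

lemma expectation_le_sqrt_expectation_square: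
  fixes f :: "'a \<Rightarrow> real"
  assumes "finite (set_pmf p)"
  shows "measure_pmf.expectation p f \<le> sqrt (measure_pmf.expectation p (\<lambda>x. (f x)\<^sup>2))"
proof -
  have "0 \<le> measure_pmf.expectation p (\<lambda>x. (f x)\<^sup>2) - (measure_pmf.expectation p f)\<^sup>2"
    using measure_pmf.variance_positive[of p f]
    by (subst (asm) measure_pmf.variance_eq) (auto intro: integrable_measure_pmf_finite assms)
  then show ?thesis by (intro real_le_rsqrt) simp
qed

lemma expectation_mono_finite:
  fixes f g :: "'a \<Rightarrow> real"
  assumes "finite (set_pmf p)" "\<And>x. f x \<le> g x"
  shows "measure_pmf.expectation p f \<le> measure_pmf.expectation p g"
  using assms by (intro integral_mono integrable_measure_pmf_finite) auto

lemma expectation_bind_le: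
  fixes g :: "'a \<Rightarrow> real" and h :: "'b \<Rightarrow> real"
  assumes fin: "finite (set_pmf p)" and finf: "\<And>x. finite (set_pmf (f x))"
    and le: "\<And>x. measure_pmf.expectation (f x) h \<le> g x"
  shows "measure_pmf.expectation (p \<bind> f) h \<le> measure_pmf.expectation p g"
proof -
  have "measure_pmf.expectation (p \<bind> f) h
      = (\<Sum>a\<in>set_pmf p. pmf p a *\<^sub>R measure_pmf.expectation (f a) h)"
    by (rule pmf_expectation_bind) (use fin finf in auto)
  also have "\<dots> \<le> (\<Sum>a\<in>set_pmf p. pmf p a *\<^sub>R g a)"
    using le by (intro sum_mono scaleR_left_mono) auto
  also have "\<dots> = measure_pmf.expectation p g"
    by (rule integral_measure_pmf[symmetric]) (use fin in auto)
  finally show ?thesis .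
qed

text \<open>Finite support makes every integrability condition automatic.\<close>

lemma finite_momentum_pair:
  fixes S :: "'q::finite \<Rightarrow> real^'m"
  shows "finite (set_pmf (momentum_pair A b B S R \<delta> \<gamma> x0 x1 k))"
  by (induction k) (auto simp: case_prod_unfold)

text \<open>Since \<open>x1\<close> is given, iterate \<open>Suc k\<close> results from only
  \<open>k\<close> random steps; hence the \<open>k - 1\<close> in the exponent of the final
  bound.\<close>

lemma momentum_iterate_Suc:
  "momentum_iterate A b B S R \<delta> \<gamma> x0 x1 (Suc k) = map_pmf snd (momentum_pair A b B S R \<delta> \<gamma> x0 x1 k)"
  by (simp add: momentum_iterate_def map_bind_pmf case_prod_unfold map_pmf_comp map_pmf_const
      flip: map_pmf_def)

section \<open>One gradient step, and the momentum recursion\<close>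

lemma pos_part_nonneg [simp]: "0 \<le> pos_part t"
  and pos_part_mult_self: "pos_part t * t = (pos_part t)\<^sup>2"
  by (auto simp: pos_part_def max_def power2_eq_square)

text \<open>The sketch gradient is \<open>x\<close> minus its B-projection onto the half-space of
  all \<open>z\<close> with \<open>s \<bullet> (A *v z - b) \<le> 0\<close>, and the loss is half
  the squared B-distance to it.\<close>

lemma norm_B_sketch_grad:
  assumes B: "sym_pos_def B" and s: "transpose A *v s \<noteq> 0"
  shows "(norm_B B (sketch_grad A b B s x))\<^sup>2 = 2 * sketch_loss A b B s x"
proof -
  let ?N = "(norm_B (matrix_inv B) (transpose A *v s))\<^sup>2"
  have N: "0 < ?N" by (rule norm_B_inverse_pos[OF B s])
  have "(norm_B B (sketch_grad A b B s x))\<^sup>2 = (pos_part (s \<bullet> (A *v x - b)) / ?N)\<^sup>2 * ?N"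
    unfolding sketch_grad_def norm_B_scaleR norm_B_inverse_squared(1)[OF B]
    by (simp only: power_mult_distrib power2_abs)
  then show ?thesis using N by (simp add: sketch_loss_def power2_eq_square)
qed

text \<open>Since \<open>s\<close> is nonnegative, the sketched half-space contains every feasible
  \<open>y\<close>; this is the variational inequality of the projection, tested at
  \<open>y\<close>.\<close>

lemma inner_sketch_grad:
  assumes B: "sym_pos_def B" and s: "transpose A *v s \<noteq> 0" "\<And>j. 0 \<le> s $ j"
    and y: "y \<in> feasible_set A b"
  shows "2 * sketch_loss A b B s x \<le> (x - y) \<bullet> (B *v sketch_grad A b B s x)"
proof -
  let ?N = "(norm_B (matrix_inv B) (transpose A *v s))\<^sup>2"
  let ?p = "pos_part (s \<bullet> (A *v x - b))"
  have N: "0 < ?N" by (rule norm_B_inverse_pos[OF B s(1)])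
  have "0 \<le> s \<bullet> (b - A *v y)"
    using y s(2) unfolding inner_vec_def
    by (intro sum_nonneg) (simp add: feasible_set_def less_eq_vec_def)
  then have "s \<bullet> (A *v x - b) \<le> s \<bullet> (A *v (x - y))"
    by (simp add: matrix_vector_mult_diff_distrib inner_diff_right)
  also have "\<dots> = (x - y) \<bullet> (transpose A *v s)"
    by (simp add: dot_lmul_matrix inner_commute flip: vector_transpose_matrix)
  finally have "?p * (s \<bullet> (A *v x - b)) / ?N \<le> ?p * ((x - y) \<bullet> (transpose A *v s)) / ?N"
    by (intro divide_right_mono mult_left_mono) auto
  then show ?thesis
    by (simp add: sketch_loss_def sketch_grad_def pos_part_mult_self matrix_vector_mult_scaleR
        spd_matrix_inv_right[OF B])
qed

lemma dist_B_gradient_step: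
  fixes A :: "real^'n^'m"
  assumes B: "sym_pos_def B" and s: "transpose A *v s \<noteq> 0" "\<And>j. 0 \<le> s $ j"
    and X: "feasible_set A b \<noteq> {}" and \<delta>: "0 < \<delta>" "\<delta> < 2"
  shows "(dist_B B (x - \<delta> *\<^sub>R sketch_grad A b B s x) (feasible_set A b))\<^sup>2
    \<le> (dist_B B x (feasible_set A b))\<^sup>2 - (2 * \<delta> - \<delta>\<^sup>2) * (2 * sketch_loss A b B s x)"
proof -
  let ?X = "feasible_set A b" and ?g = "sketch_grad A b B s x" and ?l = "2 * sketch_loss A b B s x"
  define D where "D = dist_B B (x - \<delta> *\<^sub>R ?g) ?X"
  have D: "0 \<le> D" unfolding D_def by (rule dist_B_nonneg[OF B X])
  have "0 \<le> ?l" by (simp add: sketch_loss_def)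
  moreover have "0 \<le> 2 * \<delta> - \<delta>\<^sup>2" using \<delta> by (simp add: power2_eq_square)
  ultimately have nonneg: "0 \<le> D\<^sup>2 + (2 * \<delta> - \<delta>\<^sup>2) * ?l" by (intro add_nonneg_nonneg mult_nonneg_nonneg) auto
  \<comment> \<open>The loss term is moved to the left and a root is taken, so that the bound does
    not depend on \<open>y\<close> and \<open>dist_B_greatest\<close> applies.\<close>
  have "sqrt (D\<^sup>2 + (2 * \<delta> - \<delta>\<^sup>2) * ?l) \<le> norm_B B (x - y)" if y: "y \<in> ?X" for y
  proof (rule real_le_lsqrt[OF norm_B_nonneg[OF B]])
    have sym: "?g \<bullet> (B *v (x - y)) = (x - y) \<bullet> (B *v ?g)"
      using inner_matrix_symmetric B by (metis sym_pos_def_def)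
    have "D \<le> norm_B B ((x - y) - \<delta> *\<^sub>R ?g)"
      using dist_B_le[OF B y, of "x - \<delta> *\<^sub>R ?g"] by (simp add: D_def algebra_simps)
    then have "D\<^sup>2 \<le> (norm_B B ((x - y) - \<delta> *\<^sub>R ?g))\<^sup>2" using D by (rule power_mono)
    also have "\<dots> = (norm_B B (x - y))\<^sup>2 - 2 * \<delta> * ((x - y) \<bullet> (B *v ?g)) + \<delta>\<^sup>2 * (norm_B B ?g)\<^sup>2"
      unfolding norm_B_squared[OF B] matrix_vector_mult_diff_distrib[of B "x - y"] matrix_vector_mult_scaleR
        inner_diff_left[of "x - y"] inner_diff_right inner_scaleR_left inner_scaleR_right sym
      by (simp add: power2_eq_square algebra_simps)
    also have "\<dots> \<le> (norm_B B (x - y))\<^sup>2 - 2 * \<delta> * ?l + \<delta>\<^sup>2 * ?l"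
      using inner_sketch_grad[OF B s y, of x] \<delta> norm_B_sketch_grad[OF B s(1), of b x] by simp
    finally show "D\<^sup>2 + (2 * \<delta> - \<delta>\<^sup>2) * ?l \<le> (norm_B B (x - y))\<^sup>2" by (simp add: algebra_simps)
  qed
  then have "sqrt (D\<^sup>2 + (2 * \<delta> - \<delta>\<^sup>2) * ?l) \<le> dist_B B x ?X" by (rule dist_B_greatest[OF X])
  then have "D\<^sup>2 + (2 * \<delta> - \<delta>\<^sup>2) * ?l \<le> (dist_B B x ?X)\<^sup>2"
    using nonneg by (metis power_mono real_sqrt_ge_zero real_sqrt_pow2)
  then show ?thesis by (simp add: D_def)
qed

lemma expected_dist_gradient_step:
  fixes A :: "real^'n^'m" and S :: "'q::finite \<Rightarrow> real^'m"
  assumes B: "sym_pos_def B" and S: "\<And>i. transpose A *v S i \<noteq> 0" "\<And>i j. 0 \<le> S i $ j"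
    and X: "feasible_set A b \<noteq> {}" and \<delta>: "0 < \<delta>" "\<delta> < 2"
    and lower: "\<mu>1 / 2 * (dist_B B x (feasible_set A b))\<^sup>2 \<le> expected_loss A b B S R x"
  shows "measure_pmf.expectation (R x)
      (\<lambda>i. dist_B B (x - \<delta> *\<^sub>R sketch_grad A b B (S i) x) (feasible_set A b))
    \<le> sqrt (contraction \<delta> \<mu>1) * dist_B B x (feasible_set A b)"
proof -
  let ?E = "measure_pmf.expectation (R x)" and ?d = "dist_B B x (feasible_set A b)"
  let ?D = "\<lambda>i. dist_B B (x - \<delta> *\<^sub>R sketch_grad A b B (S i) x) (feasible_set A b)"
  have int: "integrable (R x) f" for f :: "'q \<Rightarrow> real" by (rule integrable_measure_pmf_finite) simp
  have "?E ?D \<le> sqrt (?E (\<lambda>i. (?D i)\<^sup>2))" by (rule expectation_le_sqrt_expectation_square) simp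
  also have "\<dots> \<le> sqrt (contraction \<delta> \<mu>1 * ?d\<^sup>2)"
  proof (rule real_sqrt_le_mono)
    have "?E (\<lambda>i. (?D i)\<^sup>2) \<le> ?E (\<lambda>i. ?d\<^sup>2 - (2 * \<delta> - \<delta>\<^sup>2) * (2 * sketch_loss A b B (S i) x))"
      by (rule expectation_mono_finite) (simp, rule dist_B_gradient_step[OF B S X \<delta>])
    also have "\<dots> = ?d\<^sup>2 - (2 * \<delta> - \<delta>\<^sup>2) * (2 * expected_loss A b B S R x)"
      by (simp add: int expected_loss_def)
    also have "\<dots> \<le> ?d\<^sup>2 - (2 * \<delta> - \<delta>\<^sup>2) * (\<mu>1 * ?d\<^sup>2)"
    proof -
      have "0 \<le> 2 * \<delta> - \<delta>\<^sup>2" using \<delta> by (simp add: power2_eq_square)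
      then show ?thesis using lower by (intro diff_left_mono mult_left_mono) auto
    qed
    also have "\<dots> = contraction \<delta> \<mu>1 * ?d\<^sup>2" by (simp add: contraction_def algebra_simps)
    finally show "?E (\<lambda>i. (?D i)\<^sup>2) \<le> contraction \<delta> \<mu>1 * ?d\<^sup>2" .
  qed
  finally show ?thesis using dist_B_nonneg[OF B X] by (simp add: real_sqrt_mult)
qed

lemma expected_norm_sketch_grad:
  fixes A :: "real^'n^'m" and S :: "'q::finite \<Rightarrow> real^'m"
  assumes B: "sym_pos_def B" and S: "\<And>i. transpose A *v S i \<noteq> 0" and X: "feasible_set A b \<noteq> {}"
    and upper: "expected_loss A b B S R x \<le> \<mu>2 / 2 * (dist_B B x (feasible_set A b))\<^sup>2"
  shows "measure_pmf.expectation (R x) (\<lambda>i. norm_B B (sketch_grad A b B (S i) x))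
    \<le> sqrt \<mu>2 * dist_B B x (feasible_set A b)"
proof -
  let ?E = "measure_pmf.expectation (R x)" and ?d = "dist_B B x (feasible_set A b)"
  let ?g = "\<lambda>i. norm_B B (sketch_grad A b B (S i) x)"
  have "?E ?g \<le> sqrt (?E (\<lambda>i. (?g i)\<^sup>2))" by (rule expectation_le_sqrt_expectation_square) simp
  also have "?E (\<lambda>i. (?g i)\<^sup>2) = 2 * expected_loss A b B S R x"
    by (simp add: norm_B_sketch_grad[OF B S] expected_loss_def)
  also have "sqrt \<dots> \<le> sqrt (\<mu>2 * ?d\<^sup>2)" using upper by (intro real_sqrt_le_mono) simp
  finally show ?thesis using dist_B_nonneg[OF B X] by (simp add: real_sqrt_mult)
qed

text \<open>The expected distance and the expected step length satisfy a coupled linear recursion.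
  Its matrix has dominant eigenvalue \<^term>\<open>rho2 \<delta> \<gamma> \<mu>1 \<mu>2\<close>, with left eigenvector \<open>(1, w)\<close>; the
  eigenvector turns it into a one-dimensional recursion for the weighted sum.\<close>

lemma rho2_left_eigenvector:
  assumes h: "0 \<le> contraction \<delta> \<mu>1" and "0 < \<delta>" "0 \<le> \<gamma>" "0 < \<mu>2"
  obtains w where "0 \<le> w" "0 \<le> rho2 \<delta> \<gamma> \<mu>1 \<mu>2"
    "sqrt (contraction \<delta> \<mu>1) + w * (\<delta> * sqrt \<mu>2) = rho2 \<delta> \<gamma> \<mu>1 \<mu>2"
    "\<gamma> + w * \<gamma> = rho2 \<delta> \<gamma> \<mu>1 \<mu>2 * w"
proof (cases "\<gamma> = 0")
  \<comment> \<open>Without momentum the step length does not feed back, so weight 0 suffices. The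
    quotient \<open>\<gamma> / (l - \<gamma>)\<close> used below could here have denominator 0,
    namely if the contraction factor is 0.\<close>
  case True
  then have "rho2 \<delta> \<gamma> \<mu>1 \<mu>2 = sqrt (contraction \<delta> \<mu>1)" using h by (simp add: rho2_def)
  then show ?thesis using True h that[of 0] by simp
next
  case False
  define r where "r = sqrt (contraction \<delta> \<mu>1)"
  define c where "c = \<gamma> * (\<delta> * sqrt \<mu>2)"
  define q where "q = sqrt ((r - \<gamma>)\<^sup>2 + 4 * c)"
  define l where "l = rho2 \<delta> \<gamma> \<mu>1 \<mu>2"
  have c: "0 < c" using assms False by (simp add: c_def)
  have l: "l = (r + \<gamma> + q) / 2" by (simp add: l_def rho2_def q_def r_def c_def mult.assoc)
  have q2: "q\<^sup>2 = (r - \<gamma>)\<^sup>2 + 4 * c" using c by (simp add: q_def)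
  have "\<bar>r - \<gamma>\<bar> < q" unfolding q_def using c by (intro real_less_rsqrt) simp
  then have lg: "\<gamma> < l" and lr: "r < l" unfolding l by auto
  \<comment> \<open>Characteristic equation of the matrix with rows \<open>(r, \<gamma>)\<close> and
    \<open>(\<delta> * sqrt \<mu>2, \<gamma>)\<close>; the second component of the eigenvector
    equation then gives \<open>w = \<gamma> / (l - \<gamma>)\<close>.\<close>
  have eig: "(l - r) * (l - \<gamma>) = c"
    using q2 unfolding l by (simp add: power2_eq_square field_simps)
  show ?thesis
  proof (rule that[of "\<gamma> / (l - \<gamma>)", folded l_def r_def])
    have "\<gamma> / (l - \<gamma>) * (\<delta> * sqrt \<mu>2) = c / (l - \<gamma>)" by (simp add: c_def)
    also have "\<dots> = l - r" using lg by (simp flip: eig)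
    finally show "r + \<gamma> / (l - \<gamma>) * (\<delta> * sqrt \<mu>2) = l" by simp
  qed (use lg assms in \<open>auto simp: field_simps\<close>)
qed

lemma expected_dist_momentum_iterate:
  fixes A :: "real^'n^'m" and S :: "'q::finite \<Rightarrow> real^'m"
  assumes B: "sym_pos_def B" and S: "\<And>i. transpose A *v S i \<noteq> 0" "\<And>i j. 0 \<le> S i $ j"
    and X: "feasible_set A b \<noteq> {}" and \<delta>: "0 < \<delta>" "\<delta> < 2" and \<gamma>: "0 \<le> \<gamma>"
    and h: "0 \<le> contraction \<delta> \<mu>1" and \<mu>2: "0 < \<mu>2"
    and lower: "\<And>x. \<mu>1 / 2 * (dist_B B x (feasible_set A b))\<^sup>2 \<le> expected_loss A b B S R x"
    and upper: "\<And>x. expected_loss A b B S R x \<le> \<mu>2 / 2 * (dist_B B x (feasible_set A b))\<^sup>2"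
  shows "measure_pmf.expectation (momentum_iterate A b B S R \<delta> \<gamma> x0 x0 (Suc k))
      (\<lambda>x. dist_B B x (feasible_set A b)) \<le> rho2 \<delta> \<gamma> \<mu>1 \<mu>2 ^ k * dist_B B x0 (feasible_set A b)"
proof -
  let ?d = "\<lambda>x. dist_B B x (feasible_set A b)" and ?P = "momentum_pair A b B S R \<delta> \<gamma> x0 x0"
  define l where "l = rho2 \<delta> \<gamma> \<mu>1 \<mu>2"
  obtain w where w: "0 \<le> w" "0 \<le> l"
    "sqrt (contraction \<delta> \<mu>1) + w * (\<delta> * sqrt \<mu>2) = l" "\<gamma> + w * \<gamma> = l * w"
    using rho2_left_eigenvector[OF h \<delta>(1) \<gamma> \<mu>2] unfolding l_def by metis
  define \<Phi> where "\<Phi> = (\<lambda>(u, v). ?d v + w * norm_B B (v - u))"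
  have step: "measure_pmf.expectation (map_pmf (\<lambda>i. (v, v - \<delta> *\<^sub>R sketch_grad A b B (S i) v + \<gamma> *\<^sub>R (v - u))) (R v)) \<Phi>
    \<le> l * \<Phi> (u, v)" for u v
  proof -
    let ?g = "\<lambda>i. sketch_grad A b B (S i) v" and ?E = "measure_pmf.expectation (R v)"
    let ?D = "\<lambda>i. ?d (v - \<delta> *\<^sub>R ?g i)" and ?N = "\<lambda>i. norm_B B (?g i)"
    have int: "integrable (R v) f" for f :: "'q \<Rightarrow> real" by (rule integrable_measure_pmf_finite) simp
    have "?E (\<lambda>i. \<Phi> (v, v - \<delta> *\<^sub>R ?g i + \<gamma> *\<^sub>R (v - u)))
        \<le> ?E (\<lambda>i. ?D i + w * (\<delta> * ?N i) + (\<gamma> + w * \<gamma>) * norm_B B (v - u))"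
    proof (rule expectation_mono_finite)
      fix i
      \<comment> \<open>The shift \<open>\<gamma> *\<^sub>R (v - u)\<close> enters both the new
        distance and the new step length; the two triangle inequalities are the two rows of the
        recursion.\<close>
      have 1: "?d (v - \<delta> *\<^sub>R ?g i + \<gamma> *\<^sub>R (v - u)) \<le> ?D i + \<gamma> * norm_B B (v - u)"
        using dist_B_add_le[OF B X, of "v - \<delta> *\<^sub>R ?g i" "\<gamma> *\<^sub>R (v - u)"] \<gamma> by (simp add: norm_B_scaleR)
      have "norm_B B (v - \<delta> *\<^sub>R ?g i + \<gamma> *\<^sub>R (v - u) - v) \<le> \<delta> * ?N i + \<gamma> * norm_B B (v - u)"
        using norm_B_triangle[OF B, of "(- \<delta>) *\<^sub>R ?g i" "\<gamma> *\<^sub>R (v - u)"] \<delta> \<gamma>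
        unfolding norm_B_scaleR by (simp add: algebra_simps)
      from mult_left_mono[OF this w(1)] 1
      show "\<Phi> (v, v - \<delta> *\<^sub>R ?g i + \<gamma> *\<^sub>R (v - u))
        \<le> ?D i + w * (\<delta> * ?N i) + (\<gamma> + w * \<gamma>) * norm_B B (v - u)"
        by (simp add: \<Phi>_def algebra_simps)
    qed simp
    also have "\<dots> = ?E ?D + w * (\<delta> * ?E ?N) + l * w * norm_B B (v - u)"
      by (simp add: int w(4))
    also have "\<dots> \<le> sqrt (contraction \<delta> \<mu>1) * ?d v + w * (\<delta> * (sqrt \<mu>2 * ?d v)) + l * w * norm_B B (v - u)"
      using expected_dist_gradient_step[OF B S X \<delta> lower[of v]]
        expected_norm_sketch_grad[OF B S(1) X upper[of v]] w(1) \<delta>(1)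
      by (intro add_mono[OF add_mono order_refl] mult_left_mono) auto
    also have "\<dots> = (sqrt (contraction \<delta> \<mu>1) + w * (\<delta> * sqrt \<mu>2)) * ?d v + l * w * norm_B B (v - u)"
      by (simp add: algebra_simps)
    also have "\<dots> = l * \<Phi> (u, v)" unfolding w(3) by (simp add: \<Phi>_def algebra_simps)
    finally show ?thesis by simp
  qed
  have "measure_pmf.expectation (?P k) \<Phi> \<le> l ^ k * \<Phi> (x0, x0)" for k
  proof (induction k)
    case (Suc k)
    have "measure_pmf.expectation (?P (Suc k)) \<Phi> \<le> measure_pmf.expectation (?P k) (\<lambda>z. l * \<Phi> z)"
      unfolding momentum_pair.simps
      by (rule expectation_bind_le[OF finite_momentum_pair]) (use step in \<open>auto simp: case_prod_unfold\<close>)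
    also have "\<dots> = l * measure_pmf.expectation (?P k) \<Phi>" by simp
    also have "\<dots> \<le> l * (l ^ k * \<Phi> (x0, x0))" using Suc w(2) by (rule mult_left_mono)
    finally show ?case by simp
  qed simp
  moreover have "measure_pmf.expectation (?P k) (\<lambda>z. ?d (snd z)) \<le> measure_pmf.expectation (?P k) \<Phi>"
    by (rule expectation_mono_finite[OF finite_momentum_pair]) (simp add: \<Phi>_def B w(1) case_prod_unfold)
  \<comment> \<open>Equal starting points make the initial step 0, so \<open>w\<close> disappears
    from the bound.\<close>
  moreover have "\<Phi> (x0, x0) = ?d x0" by (simp add: \<Phi>_def norm_B_def)
  ultimately show ?thesis
    unfolding momentum_iterate_Suc l_def[symmetric] by (simp add: order_trans)
qed


section \<open>Probability of failure\<close>

text \<open>Yields \<open>0 < \<mu>2\<close> and, with \<open>\<mu>2 \<le> 1\<close>, a nonnegative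
  contraction factor. Comparing the loss bounds requires a point at nonzero distance: far out in the
  direction of a nonzero row, that constraint is violated.\<close>

lemma loss_constants_le:
  fixes A :: "real^'n^'m"
  assumes B: "sym_pos_def B" and X: "feasible_set A b \<noteq> {}" and row: "A $ i \<noteq> 0"
    and lower: "\<And>x. \<mu>1 / 2 * (dist_B B x (feasible_set A b))\<^sup>2 \<le> f x"
    and upper: "\<And>x. f x \<le> \<mu>2 / 2 * (dist_B B x (feasible_set A b))\<^sup>2"
  shows "\<mu>1 \<le> \<mu>2"
proof -
  define x where "x = ((\<bar>b $ i\<bar> + 1) / (A $ i \<bullet> A $ i)) *\<^sub>R A $ i"
  have "A $ i \<bullet> x = \<bar>b $ i\<bar> + 1" using row by (simp add: x_def)
  then have "0 < pos_part (A $ i \<bullet> x - b $ i)" by (simp add: pos_part_def)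
  also have "\<dots> \<le> max_violation A b x" unfolding max_violation_def by (rule Max_ge) auto
  finally have "0 < sqrt (Min (eigenvalues B)) * max_violation A b x"
    using spd_eigenvalues_pos(1)[OF B] by simp
  also have "\<dots> \<le> max_row_norm A * dist_B B x (feasible_set A b)" by (rule max_violation_le_dist[OF B X])
  finally have "dist_B B x (feasible_set A b) \<noteq> 0" by auto
  then show ?thesis using order_trans[OF lower upper, of x] by simp
qed

text \<open>On failure the violation is at least \<open>e\<close>, so a multiple of the distance
  dominates the indicator. The root \<open>s\<close> enters where the distance bounds the violation,
  \<open>t\<close> where the small solution bounds the initial distance; \<open>t / s\<close> is the
  root of the condition number.\<close>

lemma prob_not_certificate_le:
  fixes A :: "real^'n^'m"
  assumes A: "\<And>i j. A $ i $ j \<in> \<rat>" and b: "\<And>i. b $ i \<in> \<rat>" and B: "sym_pos_def B"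
    and X: "feasible_set A b \<noteq> {}" and fin: "finite (set_pmf p)" and c: "0 \<le> c"
    and psi: "0 \<le> max_row_norm A"
    and E: "measure_pmf.expectation p (\<lambda>x. dist_B B x (feasible_set A b)) \<le> c * dist_B B 0 (feasible_set A b)"
  shows "measure_pmf.prob p {x. \<not> feasibility_certificate A b x}
    \<le> sqrt (cond_number B / real CARD('n)) * max_row_norm A * 2 powr (2 * encoding_length A b - 2) * c"
proof -
  let ?X = "feasible_set A b" and ?F = "{x. \<not> feasibility_certificate A b x}"
  define e where "e = 2 powr (1 - encoding_length A b)"
  define s where "s = sqrt (Min (eigenvalues B))"
  define t where "t = sqrt (Max (eigenvalues B))"
  define n where "n = sqrt (real CARD('n))"
  have e: "0 < e" by (simp add: e_def)
  have s: "0 < s" using spd_eigenvalues_pos(1)[OF B] by (simp add: s_def)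
  have "0 \<le> Max (eigenvalues B)" using spd_eigenvalues_pos[OF B] by linarith
  then have t: "0 \<le> t" by (simp add: t_def)
  have n: "0 < n" by (simp add: n_def)
  obtain y where y: "y \<in> ?X" and "n * norm y \<le> 2 powr (encoding_length A b - 1)"
    using small_feasible_point[OF A b X] unfolding n_def by blast
  then have ny: "n * norm y \<le> inverse e" by (simp add: e_def flip: powr_minus)
  have "dist_B B 0 ?X \<le> t * norm y"
    using dist_B_le[OF B y, of 0] norm_B_bounds(2)[OF B, of "- y"] by (simp add: t_def)
  then have "n * dist_B B 0 ?X \<le> t * (n * norm y)"
    using n by (simp add: mult.left_commute)
  also have "\<dots> \<le> t * inverse e" using ny t by (rule mult_left_mono)
  finally have d0: "n * dist_B B 0 ?X \<le> t * inverse e" .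

  have "s * e * measure_pmf.prob p ?F = measure_pmf.expectation p (\<lambda>x. s * e * indicator ?F x)" by simp
  also have "\<dots> \<le> measure_pmf.expectation p (\<lambda>x. max_row_norm A * dist_B B x ?X)"
  proof (rule expectation_mono_finite[OF fin])
    fix x
    have "s * e * indicator ?F x \<le> s * max_violation A b x"
      using s e max_violation_nonneg[of A b x]
      by (auto simp: indicator_def feasibility_certificate_def e_def)
    also have "\<dots> \<le> max_row_norm A * dist_B B x ?X"
      unfolding s_def by (rule max_violation_le_dist[OF B X])
    finally show "s * e * indicator ?F x \<le> max_row_norm A * dist_B B x ?X" .
  qed
  also have "\<dots> \<le> max_row_norm A * (c * dist_B B 0 ?X)"
    using mult_left_mono[OF E psi] by simp
  finally have "n * (s * e * measure_pmf.prob p ?F) \<le> n * (max_row_norm A * (c * dist_B B 0 ?X))"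
    using n by (intro mult_left_mono) auto
  also have "\<dots> = max_row_norm A * c * (n * dist_B B 0 ?X)" by simp
  also have "\<dots> \<le> max_row_norm A * c * (t * inverse e)"
    using d0 psi c by (intro mult_left_mono mult_nonneg_nonneg)
  finally have "measure_pmf.prob p ?F \<le> max_row_norm A * c * (t * inverse e) / (n * s * e)"
    using n s e by (simp add: pos_le_divide_eq mult_ac)
  also have "\<dots> = (t / s / n) * max_row_norm A * (inverse e * inverse e) * c" by (simp add: field_simps)
  also have "inverse e * inverse e = 2 powr (2 * encoding_length A b - 2)"
    by (simp add: e_def flip: powr_minus powr_add)
  also have "t / s / n = sqrt (cond_number B / real CARD('n))"
    by (simp add: t_def s_def n_def cond_number_def real_sqrt_divide real_sqrt_mult)
  finally show ?thesis .
qed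

text \<open>The exceptional case stems from \<open>0 powr 0 = 0\<close>, whereas
  \<open>0 ^ 0 = 1\<close>.\<close>

lemma sqrt_power_eq_powr:
  assumes "0 \<le> (r::real)" "r = 0 \<Longrightarrow> k \<noteq> 0"
  shows "sqrt r ^ k = r powr (real k / 2)"
proof (cases "r = 0")
  case False
  then have "sqrt r ^ k = (r powr (1 / 2)) powr real k"
    using assms(1) by (simp add: powr_half_sqrt powr_realpow)
  then show ?thesis by (simp add: powr_powr)
qed (use assms in simp)

text \<open>For \<open>r = 0\<close> the bound is constantly 0, so strict decrease is claimed only
  for positive rates.\<close>

lemma
  assumes "0 < \<xi>" "0 < \<psi>" "0 \<le> \<alpha>" "0 < n" and r: "0 \<le> r" "r < 1"
  shows antimono_failure_bound: "antimono (\<lambda>k. failure_bound n \<sigma> \<xi> \<psi> \<alpha> k r)"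
    and failure_bound_strict: "0 < r \<Longrightarrow> k < l \<Longrightarrow>
      failure_bound n \<sigma> \<xi> \<psi> \<alpha> l r < failure_bound n \<sigma> \<xi> \<psi> \<alpha> k r"
proof -
  define C where "C = sqrt (\<xi> * (1 + \<alpha>) / real n) * \<psi> * 2 powr (2 * \<sigma> - 2)"
  have C: "0 < C" using assms by (simp add: C_def)
  have eq: "failure_bound n \<sigma> \<xi> \<psi> \<alpha> k r = C * r powr ((real k - 1) / 2)" for k
    by (simp add: failure_bound_def C_def)
  have strict: "failure_bound n \<sigma> \<xi> \<psi> \<alpha> l r < failure_bound n \<sigma> \<xi> \<psi> \<alpha> k r" if "0 < r" "k < l" for k l
    unfolding eq using C that r by (intro mult_strict_left_mono powr_less_mono') auto
  then show "0 < r \<Longrightarrow> k < l \<Longrightarrow> failure_bound n \<sigma> \<xi> \<psi> \<alpha> l r < failure_bound n \<sigma> \<xi> \<psi> \<alpha> k r" .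
  show "antimono (\<lambda>k. failure_bound n \<sigma> \<xi> \<psi> \<alpha> k r)"
  proof (rule antimonoI)
    fix k l :: nat assume "k \<le> l"
    then show "failure_bound n \<sigma> \<xi> \<psi> \<alpha> l r \<le> failure_bound n \<sigma> \<xi> \<psi> \<alpha> k r"
      using strict[of k l] r(1) eq by (cases "r = 0"; cases "k = l") auto
  qed
qed

lemma rho_bar_ge:
  shows "cond_Q \<delta> \<gamma> \<mu>1 \<mu>2 \<Longrightarrow> (rho2 \<delta> \<gamma> \<mu>1 \<mu>2)\<^sup>2 \<le> rho_bar \<delta> \<gamma> \<zeta> \<mu>1 \<mu>2 \<rho>"
    and "cond_RS \<delta> \<gamma> \<zeta> \<mu>1 \<mu>2 \<Longrightarrow> \<rho> \<le> rho_bar \<delta> \<gamma> \<zeta> \<mu>1 \<mu>2 \<rho>"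
proof -
  let ?R = "{r. (cond_Q \<delta> \<gamma> \<mu>1 \<mu>2 \<and> r = (rho2 \<delta> \<gamma> \<mu>1 \<mu>2)\<^sup>2) \<or> (cond_RS \<delta> \<gamma> \<zeta> \<mu>1 \<mu>2 \<and> r = \<rho>)}"
  have "finite ?R" by (rule finite_subset[of _ "{(rho2 \<delta> \<gamma> \<mu>1 \<mu>2)\<^sup>2, \<rho>}"]) auto
  then have "r \<in> ?R \<Longrightarrow> r \<le> rho_bar \<delta> \<gamma> \<zeta> \<mu>1 \<mu>2 \<rho>" for r
    unfolding rho_bar_def by (rule Max_ge)
  then show "cond_Q \<delta> \<gamma> \<mu>1 \<mu>2 \<Longrightarrow> (rho2 \<delta> \<gamma> \<mu>1 \<mu>2)\<^sup>2 \<le> rho_bar \<delta> \<gamma> \<zeta> \<mu>1 \<mu>2 \<rho>"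
    and "cond_RS \<delta> \<gamma> \<zeta> \<mu>1 \<mu>2 \<Longrightarrow> \<rho> \<le> rho_bar \<delta> \<gamma> \<zeta> \<mu>1 \<mu>2 \<rho>" by auto
qed

theorem theorem6p8:
  fixes A :: "real^'n^'m" and b :: "real^'m" and B :: "real^'n^'n"
    and S :: "'q::finite \<Rightarrow> real^'m" and R :: "real^'n \<Rightarrow> 'q pmf"
    and \<delta> \<gamma> \<zeta> \<mu>1 \<mu>2 \<alpha> \<rho> \<rho>bar \<sigma> \<xi> \<psi> :: real
  assumes rows_nonzero: "\<And>i. A $ i \<noteq> 0"
    and A_rational: "\<And>i j. A $ i $ j \<in> \<rat>"
    and b_rational: "\<And>i. b $ i \<in> \<rat>"
    and B_spd: "sym_pos_def B"
    and S_nonneg: "\<And>i j. 0 \<le> S i $ j"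
    and S_nonzero: "\<And>i. transpose A *v S i \<noteq> 0"
    and mu1_pos: "0 < \<mu>1"
    and mu2_le: "\<mu>2 \<le> 1"
    and loss_lower: "\<And>x. \<mu>1 / 2 * (dist_B B x (feasible_set A b))\<^sup>2 \<le> expected_loss A b B S R x"
    and loss_upper: "\<And>x. expected_loss A b B S R x \<le> \<mu>2 / 2 * (dist_B B x (feasible_set A b))\<^sup>2"
    and delta: "0 < \<delta>" "\<delta> < 2"
    and gamma: "0 \<le> \<gamma>"
    and zeta: "0 \<le> \<zeta>"
    and condition: "cond_Q \<delta> \<gamma> \<mu>1 \<mu>2 \<or> cond_RS \<delta> \<gamma> \<zeta> \<mu>1 \<mu>2"
    and alpha: "0 \<le> \<alpha>"
    and rho: "cond_RS \<delta> \<gamma> \<zeta> \<mu>1 \<mu>2 \<Longrightarrow> 0 < \<rho> \<and> \<rho> < 1"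
    and mean_square_rate:
      "\<And>k. cond_RS \<delta> \<gamma> \<zeta> \<mu>1 \<mu>2 \<Longrightarrow>
         measure_pmf.expectation (momentum_iterate A b B S R \<delta> \<gamma> 0 0 (k + 1))
           (\<lambda>x. (dist_B B x (feasible_set A b))\<^sup>2)
         \<le> \<rho> ^ k * (1 + \<alpha>) * (dist_B B 0 (feasible_set A b))\<^sup>2"
    and rho_bar: "\<rho>bar = rho_bar \<delta> \<gamma> \<zeta> \<mu>1 \<mu>2 \<rho>"
    and rho_bar_less: "\<rho>bar < 1"
    and sigma: "\<sigma> = encoding_length A b"
    and xi: "\<xi> = cond_number B"
    and psi: "\<psi> = max_row_norm A"
  shows "(\<forall>k::nat.
            (4 * \<sigma> - 4 - log 2 (real CARD('n)) + log 2 (1 + \<alpha>) + log 2 \<xi> + 2 * log 2 \<psi>)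
              / log 2 (1 / \<rho>bar) < real k - 1 \<longrightarrow>
            feasible_set A b \<noteq> {} \<longrightarrow>
            measure_pmf.prob (momentum_iterate A b B S R \<delta> \<gamma> 0 0 k)
                {x. \<not> feasibility_certificate A b x}
              \<le> failure_bound CARD('n) \<sigma> \<xi> \<psi> \<alpha> k \<rho>bar)
       \<and> antimono (\<lambda>k. failure_bound CARD('n) \<sigma> \<xi> \<psi> \<alpha> k \<rho>bar)
       \<and> (0 < \<rho>bar \<longrightarrow>
            (\<forall>k l. k < l \<longrightarrow>
               failure_bound CARD('n) \<sigma> \<xi> \<psi> \<alpha> l \<rho>bar < failure_bound CARD('n) \<sigma> \<xi> \<psi> \<alpha> k \<rho>bar))"
proof -
  let ?X = "feasible_set A b" and ?it = "momentum_iterate A b B S R \<delta> \<gamma> 0 0"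
  let ?d = "\<lambda>x. dist_B B x ?X" and ?H = "\<lambda>k. failure_bound CARD('n) \<sigma> \<xi> \<psi> \<alpha> k \<rho>bar"
  have "norm (A $ undefined) \<le> \<psi>" unfolding psi max_row_norm_def by (rule Max_ge) auto
  then have psi_pos: "0 < \<psi>" using rows_nonzero[of undefined] by (meson less_le_trans zero_less_norm_iff)
  have xi_pos: "0 < \<xi>" using spd_eigenvalues_pos[OF B_spd] by (simp add: xi cond_number_def)
  have rhobar_nonneg: "0 \<le> \<rho>bar"
    using condition rho rho_bar_ge(1)[of \<delta> \<gamma> \<mu>1 \<mu>2 \<zeta> \<rho>]
      rho_bar_ge(2)[of \<delta> \<gamma> \<zeta> \<mu>1 \<mu>2 \<rho>] unfolding rho_bar
    by (meson less_imp_le order_trans zero_le_power2)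
  have anti: "antimono ?H"
    using xi_pos psi_pos alpha rhobar_nonneg rho_bar_less by (intro antimono_failure_bound) auto
  have strict: "0 < \<rho>bar \<Longrightarrow> k < l \<Longrightarrow> ?H l < ?H k" for k l
    using xi_pos psi_pos alpha rhobar_nonneg rho_bar_less by (intro failure_bound_strict) auto

  have bound: "measure_pmf.prob (?it (Suc k)) {x. \<not> feasibility_certificate A b x} \<le> ?H (Suc k)"
    if X: "?X \<noteq> {}" and k: "\<rho>bar = 0 \<Longrightarrow> k \<noteq> 0" for k
  proof -
    have fin: "finite (set_pmf (?it (Suc k)))"
      unfolding momentum_iterate_def by (simp add: finite_momentum_pair del: momentum_pair.simps)
    have d0: "0 \<le> ?d 0" by (rule dist_B_nonneg[OF B_spd X])
    have "measure_pmf.expectation (?it (Suc k)) ?d \<le> sqrt (1 + \<alpha>) * sqrt \<rho>bar ^ k * ?d 0"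
    \<comment> \<open>\<rho>bar dominates both rates, so either would do if both conditions hold.
      The assumed mean square rate is preferred; under (Q) alone the rate is derived.\<close>
    proof (cases "cond_RS \<delta> \<gamma> \<zeta> \<mu>1 \<mu>2")
      case True
      have "measure_pmf.expectation (?it (Suc k)) ?d \<le> sqrt (measure_pmf.expectation (?it (Suc k)) (\<lambda>x. (?d x)\<^sup>2))"
        by (rule expectation_le_sqrt_expectation_square[OF fin])
      also have "\<dots> \<le> sqrt (\<rho> ^ k * (1 + \<alpha>) * (?d 0)\<^sup>2)"
        using mean_square_rate[OF True, of k] by (intro real_sqrt_le_mono) simp
      also have "\<dots> \<le> sqrt (\<rho>bar ^ k * (1 + \<alpha>) * (?d 0)\<^sup>2)"
        using rho[OF True] rho_bar_ge(2)[OF True, of \<rho>] alpha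
        by (intro real_sqrt_le_mono mult_right_mono power_mono) (auto simp: rho_bar)
      also have "\<dots> = sqrt (1 + \<alpha>) * sqrt \<rho>bar ^ k * ?d 0"
        using d0 by (simp add: real_sqrt_mult real_sqrt_power)
      finally show ?thesis .
    next
      case False
      then have Q: "cond_Q \<delta> \<gamma> \<mu>1 \<mu>2" using condition by blast
      have mu: "\<mu>1 \<le> \<mu>2"
        using loss_constants_le[OF B_spd X rows_nonzero loss_lower loss_upper] .
      have "\<delta> * (2 - \<delta>) \<le> 1" using zero_le_power2[of "\<delta> - 1"] by (simp add: power2_eq_square algebra_simps)
      then have "(2 * \<delta> - \<delta>\<^sup>2) * \<mu>1 \<le> 1 * 1"
        using mu mu1_pos mu2_le by (intro mult_mono) (auto simp: power2_eq_square algebra_simps)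
      then have h: "0 \<le> contraction \<delta> \<mu>1" by (simp add: contraction_def)
      have mu2: "0 < \<mu>2" using mu mu1_pos by simp
      have r0: "0 \<le> rho2 \<delta> \<gamma> \<mu>1 \<mu>2" using rho2_left_eigenvector[OF h delta(1) gamma mu2] by blast
      have "measure_pmf.expectation (?it (Suc k)) ?d \<le> rho2 \<delta> \<gamma> \<mu>1 \<mu>2 ^ k * ?d 0"
        by (rule expected_dist_momentum_iterate[OF B_spd S_nonzero S_nonneg X delta gamma h mu2 loss_lower loss_upper])
      also have "\<dots> \<le> (sqrt (1 + \<alpha>) * sqrt \<rho>bar ^ k) * ?d 0"
      proof (rule mult_right_mono[OF _ d0])
        have "rho2 \<delta> \<gamma> \<mu>1 \<mu>2 \<le> sqrt \<rho>bar"
          using rho_bar_ge(1)[OF Q, of \<zeta> \<rho>] by (intro real_le_rsqrt) (simp add: rho_bar)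
        \<comment> \<open>Under (Q) alone \<alpha> is arbitrary; the factor
          \<open>sqrt (1 + \<alpha>)\<close> is at least 1 and brings the bound into the shape of
          the other case.\<close>
        then have "1 * rho2 \<delta> \<gamma> \<mu>1 \<mu>2 ^ k \<le> sqrt (1 + \<alpha>) * sqrt \<rho>bar ^ k"
          using alpha r0 by (intro mult_mono power_mono) auto
        then show "rho2 \<delta> \<gamma> \<mu>1 \<mu>2 ^ k \<le> sqrt (1 + \<alpha>) * sqrt \<rho>bar ^ k" by simp
      qed
      finally show ?thesis .
    qed
    then have "measure_pmf.prob (?it (Suc k)) {x. \<not> feasibility_certificate A b x}
        \<le> sqrt (\<xi> / real CARD('n)) * \<psi> * 2 powr (2 * \<sigma> - 2) * (sqrt (1 + \<alpha>) * sqrt \<rho>bar ^ k)"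
      unfolding xi psi sigma using psi_pos alpha rhobar_nonneg
      by (intro prob_not_certificate_le[OF A_rational b_rational B_spd X fin]) (auto simp: psi)
    also have "\<dots> = ?H (Suc k)"
      using sqrt_power_eq_powr[OF rhobar_nonneg k]
      by (simp add: failure_bound_def real_sqrt_mult real_sqrt_divide)
    finally show ?thesis .
  qed

  \<comment> \<open>If \<open>\<rho>bar = 0\<close>, the left-hand side of the hypothesis on \<open>k\<close> is 0 by the conventions for \<open>log\<close>
    and division, which forces \<open>k \<ge> 2\<close>. For \<open>k = 0\<close> the bound follows from \<open>k = 1\<close>, as \<open>x\<^sub>0 = x\<^sub>1\<close>.\<close>
  have main: "measure_pmf.prob (?it k) {x. \<not> feasibility_certificate A b x} \<le> ?H k"
    if k: "(4 * \<sigma> - 4 - log 2 (real CARD('n)) + log 2 (1 + \<alpha>) + log 2 \<xi> + 2 * log 2 \<psi>)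
        / log 2 (1 / \<rho>bar) < real k - 1" and X: "?X \<noteq> {}" for k
  proof (cases "\<rho>bar = 0")
    case True
    then have "1 < k" using k by (simp add: log_def)
    then show ?thesis using bound[OF X, of "k - 1"] by simp
  next
    case False
    show ?thesis
    proof (cases k)
      case 0
      have "?it 0 = ?it (Suc 0)" by (simp add: momentum_iterate_Suc) (simp add: momentum_iterate_def)
      then have "measure_pmf.prob (?it k) {x. \<not> feasibility_certificate A b x} \<le> ?H (Suc 0)"
        using bound[OF X, of 0] False 0 by simp
      also have "\<dots> \<le> ?H k" using antimonoD[OF anti, of k "Suc 0"] 0 by simp
      finally show ?thesis .
    qed (use bound[OF X] False in simp)
  qed
  show ?thesis using main anti strict by blast
qed

end
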